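(* Let $\alpha\in Y^*$ and assume that the eigenvalues $\lambda_1^\alpha,\dots,\lambda_N^\alpha$ of the generalised capacitance matrix $\mathcal{C}^\alpha_G=\mathsf{V}^2\mathsf{L}^{-1}\mathcal{C}^\alpha$, i.e. of the eigenvalue problem $$\mathcal{C}^\alpha_G\,\boldsymbol a_i=\lambda_i^\alpha\,\boldsymbol a_i,\qquad 1\le i\le N,$$ are simple. Then, as $\delta\to0$, the $N$ subwavelength resonances $\omega_1^\alpha,\dots,\omega_N^\alpha$ (the subwavelength band functions evaluated at $\alpha$) satisfy $$\omega_i^\alpha=\pm\sqrt{\delta\lambda_i^\alpha}+O(\delta),\qquad 1\le i\le N,$$ where, by convention, the $N$ values of $\pm\sqrt{\delta\lambda_i^\alpha}$ having positive real parts are selected.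
   Context: Geometry: $N\ge1$; points $0=x_1^{\mathsf L}<x_1^{\mathsf R}<x_2^{\mathsf L}<\dots<x_N^{\mathsf L}<x_N^{\mathsf R}$, a period $L>x_N^{\mathsf R}-x_1^{\mathsf L}$, extended to $i\in\mathbb Z$ by $x_{i+N}^{\mathsf L}=x_i^{\mathsf L}+L$, $x_{i+N}^{\mathsf R}=x_i^{\mathsf R}+L$. Put $D_i=(x_i^{\mathsf L},x_i^{\mathsf R})$ (resonators), $\ell_i=x_i^{\mathsf R}-x_i^{\mathsf L}$, $s_i=x_{i+1}^{\mathsf L}-x_i^{\mathsf R}$, $s_0=s_N$, $\mathfrak C=\bigcup_{i\in\mathbb Z}D_i$, $Y^*=\mathbb R/\frac{2\pi}{L}\mathbb Z$. Material parameters: $v>0$ (background wave speed) and nonzero $v_1,\dots,v_N$ (wave speeds in the resonators, either all real positive, or complex), and the contrast $\delta>0$. The geometry, $v$ and the $v_i$ are fixed while $\delta\to0$. Spectral problem: for $\alpha\in Y^*$, find $\omega\in\mathbb C$ and a nontrivial continuous $u$ with - $u''+\frac{\omega^2}{v^2}u=0$ in $\mathbb R\setminus\overline{\mathfrak C}$, and $u''+\frac{\omega^2}{v_i^2}u=0$ in $D_i+L\mathbb Z$ for $1\le i\le N$; - for all $i\in\mathbb Z$: $u'(x_i^{\mathsf L}+0)=\delta\,u'(x_i^{\mathsf L}-0)$ and $\delta\,u'(x_i^{\mathsf R}+0)=u'(x_i^{\mathsf R}-0)$; - $u(x+L)=e^{\mathrm i\alpha L}u(x)$. A frequency $\omega^\alpha(\delta)$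 for which there is a nontrivial solution is a scattering resonance; it is a subwavelength resonance if in addition $\omega^\alpha(\delta)\to0$ as $\delta\to0$. Quasiperiodic capacitance matrix $\mathcal C^\alpha\in\mathbb C^{N\times N}$: for $1\le j\le N$ let $V_j^\alpha$ be the continuous function with $(V_j^\alpha)''=0$ on $\mathbb R\setminus\overline{\mathfrak C}$, $V_j^\alpha=\delta_{ij}$ on $D_i$ ($1\le i\le N$), $V_j^\alpha(x+mL)=e^{\mathrm i\alpha mL}V_j^\alpha(x)$ for $m\in\mathbb Z$. Then $\mathcal C^\alpha_{ij}=-\int_{\partial D_i}\frac{\partial V_j^\alpha}{\partial\nu}\,d\sigma=(V_j^\alpha)'(x_i^{\mathsf L}-0)-(V_j^\alpha)'(x_i^{\mathsf R}+0)$. Moreover $\mathsf L=\mathrm{diag}(\ell_1,\dots,\ell_N)$ and $\mathsf V=\mathrm{diag}(v_1,\dots,v_N)$. *)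

theory Defs
  imports
    "HOL-Analysis.Analysis"
    "HOL-Library.Landau_Symbols"
    "Jordan_Normal_Form.Char_Poly"
begin

definition resonator_chain ::
  "nat \<Rightarrow> real \<Rightarrow> (int \<Rightarrow> real) \<Rightarrow> (int \<Rightarrow> real) \<Rightarrow> bool" where
  "resonator_chain N L xL xR \<longleftrightarrow>
     N \<ge> 1 \<and> xL 1 = 0 \<and>
     (\<forall>i\<in>{1..int N}. xL i < xR i) \<and>
     (\<forall>i\<in>{1..<int N}. xR i < xL (i + 1)) \<and>
     L > xR (int N) - xL 1 \<and>
     (\<forall>i. xL (i + int N) = xL i + L \<and> xR (i + int N) = xR i + L)"

definition resonators :: "(int \<Rightarrow> real) \<Rightarrow> (int \<Rightarrow> real) \<Rightarrow> real set" where
  "resonators xL xR = (\<Union>i. {xL i<..<xR i})"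

definition resonator_translates ::
  "real \<Rightarrow> (int \<Rightarrow> real) \<Rightarrow> (int \<Rightarrow> real) \<Rightarrow> int \<Rightarrow> real set" where
  "resonator_translates L xL xR i =
     (\<Union>m::int. {xL i + of_int m * L<..<xR i + of_int m * L})"

abbreviation vderiv :: "(real \<Rightarrow> complex) \<Rightarrow> real \<Rightarrow> complex" where
  "vderiv u \<equiv> (\<lambda>y. vector_derivative u (at y))"

text \<open>The equation u'' + c u = 0 on S, for S open.\<close>

definition helmholtz_on :: "real set \<Rightarrow> complex \<Rightarrow> (real \<Rightarrow> complex) \<Rightarrow> bool" where
  "helmholtz_on S c u \<longleftrightarrow>
     (\<forall>x\<in>S. u differentiable (at x) \<and> (vderiv u has_vector_derivative - (c * u x)) (at x))"

text \<open>u'(x_i^L + 0) = \<delta> u'(x_i^L - 0) and \<delta> u'(x_i^R + 0) = u'(x_i^R - 0),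
  including the existence of the four one-sided limits.\<close>

definition transmission ::
  "(int \<Rightarrow> real) \<Rightarrow> (int \<Rightarrow> real) \<Rightarrow> real \<Rightarrow> (real \<Rightarrow> complex) \<Rightarrow> bool" where
  "transmission xL xR \<delta> u \<longleftrightarrow>
     (\<forall>i. (\<exists>p q. (vderiv u \<longlongrightarrow> p) (at_right (xL i)) \<and> (vderiv u \<longlongrightarrow> q) (at_left (xL i)) \<and>
                  p = of_real \<delta> * q) \<and>
          (\<exists>p q. (vderiv u \<longlongrightarrow> p) (at_right (xR i)) \<and> (vderiv u \<longlongrightarrow> q) (at_left (xR i)) \<and>
                  of_real \<delta> * p = q))"

text \<open>The quasimomentum in R / (2 pi / L) Z is given by a real representative \<alpha>; it enters only
  through exp(i \<alpha> L m) with m an integer.  The wave speed in the i-th resonator is vr i,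
  for i = 1, ..., N.\<close>

definition bloch_mode ::
  "nat \<Rightarrow> real \<Rightarrow> (int \<Rightarrow> real) \<Rightarrow> (int \<Rightarrow> real) \<Rightarrow> real \<Rightarrow> (nat \<Rightarrow> complex) \<Rightarrow>
   real \<Rightarrow> real \<Rightarrow> complex \<Rightarrow> (real \<Rightarrow> complex) \<Rightarrow> bool" where
  "bloch_mode N L xL xR v vr \<alpha> \<delta> w u \<longleftrightarrow>
     continuous_on UNIV u \<and> (\<exists>x. u x \<noteq> 0) \<and>
     helmholtz_on (- closure (resonators xL xR)) (w\<^sup>2 / (of_real v)\<^sup>2) u \<and>
     (\<forall>i\<in>{1..N}. helmholtz_on (resonator_translates L xL xR (int i)) (w\<^sup>2 / (vr i)\<^sup>2) u) \<and>
     transmission xL xR \<delta> u \<and>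
     (\<forall>x. u (x + L) = cis (\<alpha> * L) * u x)"

definition scattering_resonance ::
  "nat \<Rightarrow> real \<Rightarrow> (int \<Rightarrow> real) \<Rightarrow> (int \<Rightarrow> real) \<Rightarrow> real \<Rightarrow> (nat \<Rightarrow> complex) \<Rightarrow>
   real \<Rightarrow> real \<Rightarrow> complex \<Rightarrow> bool" where
  "scattering_resonance N L xL xR v vr \<alpha> \<delta> w \<longleftrightarrow> (\<exists>u. bloch_mode N L xL xR v vr \<alpha> \<delta> w u)"

text \<open>A subwavelength resonance is a function of the contrast \<delta> (only its germ at 0+ matters).\<close>

definition subwavelength_resonance ::
  "nat \<Rightarrow> real \<Rightarrow> (int \<Rightarrow> real) \<Rightarrow> (int \<Rightarrow> real) \<Rightarrow> real \<Rightarrow> (nat \<Rightarrow> complex) \<Rightarrow>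
   real \<Rightarrow> (real \<Rightarrow> complex) \<Rightarrow> bool" where
  "subwavelength_resonance N L xL xR v vr \<alpha> w \<longleftrightarrow>
     (\<forall>\<^sub>F \<delta> in at_right 0. scattering_resonance N L xL xR v vr \<alpha> \<delta> (w \<delta>)) \<and>
     (w \<longlongrightarrow> 0) (at_right 0)"

definition is_cap_potential ::
  "nat \<Rightarrow> real \<Rightarrow> (int \<Rightarrow> real) \<Rightarrow> (int \<Rightarrow> real) \<Rightarrow> real \<Rightarrow> nat \<Rightarrow> (real \<Rightarrow> complex) \<Rightarrow> bool" where
  "is_cap_potential N L xL xR \<alpha> j V \<longleftrightarrow>
     continuous_on UNIV V \<and>
     helmholtz_on (- closure (resonators xL xR)) 0 V \<and>
     (\<forall>i\<in>{1..N}. \<forall>x\<in>{xL (int i)<..<xR (int i)}. V x = (if i = j then 1 else 0)) \<and>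
     (\<forall>x. \<forall>m::int. V (x + of_int m * L) = cis (\<alpha> * of_int m * L) * V x)"

definition cap_potential ::
  "nat \<Rightarrow> real \<Rightarrow> (int \<Rightarrow> real) \<Rightarrow> (int \<Rightarrow> real) \<Rightarrow> real \<Rightarrow> nat \<Rightarrow> real \<Rightarrow> complex" where
  "cap_potential N L xL xR \<alpha> j = (THE V. is_cap_potential N L xL xR \<alpha> j V)"

text \<open>Matrix indices start at 0, resonator indices at 1.\<close>

definition cap_matrix ::
  "nat \<Rightarrow> real \<Rightarrow> (int \<Rightarrow> real) \<Rightarrow> (int \<Rightarrow> real) \<Rightarrow> real \<Rightarrow> complex mat" where
  "cap_matrix N L xL xR \<alpha> = Matrix.mat N N (\<lambda>(i, j).
     Lim (at_left (xL (int (Suc i)))) (vderiv (cap_potential N L xL xR \<alpha> (Suc j)))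
   - Lim (at_right (xR (int (Suc i)))) (vderiv (cap_potential N L xL xR \<alpha> (Suc j))))"

definition gen_cap_matrix ::
  "nat \<Rightarrow> real \<Rightarrow> (int \<Rightarrow> real) \<Rightarrow> (int \<Rightarrow> real) \<Rightarrow> (nat \<Rightarrow> complex) \<Rightarrow> real \<Rightarrow> complex mat" where
  "gen_cap_matrix N L xL xR vr \<alpha> =
     (mat_diag N (\<lambda>i. vr (Suc i))) ^\<^sub>m 2
     * mat_diag N (\<lambda>i. inverse (of_real (xR (int (Suc i)) - xL (int (Suc i)))))
     * cap_matrix N L xL xR \<alpha>"

end

theory Submission
  imports Defs "HOL-Complex_Analysis.Cauchy_Integral_Formula"
begin

text \<open>Put \<open>\<mu> = w\<^sup>2 / \<delta>\<close>. Propagating the pair (value, outer derivative) from one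
  left end point to the next, \<open>w\<close> is a scattering resonance iff the monodromy matrix over one period,
  which has determinant 1, has the eigenvalue \<open>cis (\<alpha> * L)\<close>, i.e. iff its trace equals
  \<open>2 * cos (\<alpha> * L)\<close>. The trace is an entire function of \<open>\<mu>\<close> which differs by \<open>O(\<delta>)\<close>, locally
  uniformly, from a polynomial of degree at most \<open>N\<close>; the latter describes the discrete problem of the
  capacitance matrix, so the \<open>N\<close> distinct eigenvalues are all the zeros of the limit equation, and
  they are simple. Each of them continues to a zero \<open>\<mu>\<^sub>i(\<delta>) = \<lambda>\<^sub>i + O(\<delta>)\<close>. Since the trace grows like
  \<open>\<mu> ^ N\<close> as long as \<open>w\<close> and \<open>\<delta>\<close> are small, subwavelength resonances have bounded \<open>\<mu>\<close>, and by
  compactness there are no further ones.\<close>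

section \<open>Perturbation of simple zeros\<close>

text \<open>Only w^2 enters the equations, so the perturbation argument is carried out for \<mu>,
  where everything is entire; a branch of the square root is chosen only at the end. The outer
  derivative is taken as state because a cell then contains \<delta> only as a factor and inside
  entire functions of \<delta> \<mu>, without inverse powers, so that \<delta> = 0 is an admissible
  value. That the eigenvalues exhaust the limit zeros rests on counting, not on a converse: each
  eigenvector yields a zero, and a nonzero polynomial of degree at most N with N distinct zeros has
  no others and no double ones. The main obstacle is completeness. A resonance tends to 0 without
  any rate, so \<mu> could be unbounded. Divided by \<mu>^N, the trace becomes continuous in
  (1/\<mu>, w^2, \<delta>) up to the origin, where its value, the product of - l_i s_i / v_i^2, is
  nonzero; this confines \<mu> to a fixed disc. An eigenvalue can be 0, as happens for \<alpha> = 0.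
  The square root is not Lipschitz there, but w^2 = O(\<delta>^2) still gives w =
  O(\<delta>).\<close>

text \<open>The centre moves by at most r / 2 and distances are halved, so every point of the ball
  stays within r / 2 + r / 2 of the centre. The ball is thus mapped into itself and Banach's theorem
  applies.\<close>

lemma Banach_fix_cball:
  fixes g :: "complex \<Rightarrow> complex"
  assumes "0 \<le> r" and lip: "\<And>x y. x \<in> cball a r \<Longrightarrow> y \<in> cball a r \<Longrightarrow> dist (g x) (g y) \<le> 1/2 * dist x y"
    and start: "dist a (g a) \<le> r / 2"
  shows "\<exists>!x. x \<in> cball a r \<and> g x = x"
proof -
  have maps: "g ` cball a r \<subseteq> cball a r"
  proof (intro image_subsetI)
    fix x assume x: "x \<in> cball a r"
    have "dist a (g x) \<le> dist a (g a) + dist (g a) (g x)" by (rule dist_triangle)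
    also have "dist (g a) (g x) \<le> 1/2 * dist a x" using lip[of a x] x assms(1) by simp
    also have "dist a x \<le> r" using x by simp
    finally show "g x \<in> cball a r" using start by simp
  qed
  show ?thesis
  proof (rule Banach_fix[of _ "1/2"])
    show "complete (cball a r)" by (simp add: complete_eq_closed)
    show "cball a r \<noteq> {}" using assms(1) by auto
  qed (use maps lip in auto)
qed

text \<open>Newton's map with frozen slope is a contraction near a simple zero, uniformly in the perturbation.\<close>

lemma simple_zero_perturbation:
  fixes f :: "real \<Rightarrow> complex \<Rightarrow> complex"
  assumes hol: "\<And>\<delta>. f \<delta> holomorphic_on UNIV"
    and zero: "f 0 z = 0" and simple: "deriv (f 0) z \<noteq> 0" and "R > 0" and "C \<ge> 0"
    and bound: "\<And>\<delta> y. 0 \<le> \<delta> \<Longrightarrow> \<delta> \<le> 1 \<Longrightarrow> cmod (y - z) \<le> R \<Longrightarrow> cmod (f \<delta> y - f 0 y) \<le> C * \<delta>"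
  shows "\<exists>r K. 0 < r \<and> (\<forall>\<^sub>F \<delta> in at_right 0. \<exists>y. f \<delta> y = 0 \<and> cmod (y - z) \<le> K * \<delta> \<and>
           cmod (y - z) \<le> r \<and> (\<forall>y'. cmod (y' - z) \<le> r \<longrightarrow> f \<delta> y' = 0 \<longrightarrow> y' = y))"
proof -
  define D where "D = deriv (f 0) z"
  have D: "cmod D > 0" and D0: "D \<noteq> 0" using simple by (simp_all add: D_def)
  have der: "(f \<delta> has_field_derivative deriv (f \<delta>) y) (at y)" for \<delta> y
    using hol[of \<delta>] by (simp add: holomorphic_derivI)
  have "continuous_on UNIV (deriv (f 0))"
    using holomorphic_deriv[OF hol[of 0]] holomorphic_on_imp_continuous_on by blast
  hence "isCont (deriv (f 0)) z" by (simp add: continuous_on_eq_continuous_at)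
  then obtain d where d: "d > 0" "\<And>y. dist y z < d \<Longrightarrow> dist (deriv (f 0) y) D < cmod D / 4"
    using D unfolding continuous_at_eps_delta D_def by (metis zero_less_divide_iff zero_less_numeral)
  \<comment> \<open>\<open>r \<le> R/2\<close> leaves, around every point of the ball, a disc of
    radius \<open>R/2\<close> on which \<open>bound\<close> is available for Cauchy's inequality.
    \<open>r < d\<close> keeps the derivative of \<open>f 0\<close> within a quarter of
    \<open>cmod D\<close>.\<close>
  define r where "r = min (R/2) (d/2)"
  have r: "0 < r" "r \<le> R/2" "r < d"
    using d(1) assms by (auto simp: r_def)
  \<comment> \<open>Two smallness conditions: \<open>C * \<delta> \<le> cmod D * R / 8\<close> makes
    the perturbation of the derivative at most \<open>cmod D / 4\<close>, and
    \<open>C * \<delta> \<le> cmod D * r / 2\<close> makes the first Newton step at most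
    \<open>r / 2\<close>. Writing \<open>C + 1\<close> covers \<open>C = 0\<close>.\<close>
  define \<eta> where "\<eta> = min 1 (min (cmod D * R / (8 * (C + 1))) (cmod D * r / (2 * (C + 1))))"
  have \<eta>: "0 < \<eta>" using D r assms by (auto simp: \<eta>_def)
  have main: "\<exists>y. f \<delta> y = 0 \<and> cmod (y - z) \<le> 2 * C / cmod D * \<delta> \<and>
           cmod (y - z) \<le> r \<and> (\<forall>y'. cmod (y' - z) \<le> r \<longrightarrow> f \<delta> y' = 0 \<longrightarrow> y' = y)"
    if \<delta>: "0 < \<delta>" "\<delta> < \<eta>" for \<delta>
  proof -
    have \<delta>1: "\<delta> \<le> 1" "(C + 1) * \<delta> \<le> cmod D * R / 8" "(C + 1) * \<delta> \<le> cmod D * r / 2"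
      using \<delta> \<open>C \<ge> 0\<close> by (auto simp: \<eta>_def field_simps)
    have C\<delta>: "C * \<delta> \<le> cmod D * R / 8" "C * \<delta> \<le> cmod D * r / 2"
      using \<delta>1 \<delta> by (auto simp: algebra_simps)
    define g where "g y = y - f \<delta> y / D" for y
    have fixed: "g y = y \<longleftrightarrow> f \<delta> y = 0" for y using D0 by (simp add: g_def diff_eq_eq)
    have dd: "cmod (deriv (f \<delta>) y - D) \<le> cmod D / 2" if y: "y \<in> cball z r" for y
    proof -
      define h where "h x = f \<delta> x - f 0 x" for x
      \<comment> \<open>Holomorphy turns the bound on values into a bound on derivatives, so no
        assumption on the derivative of the perturbation has to be made.\<close>
      have "cmod ((deriv ^^ 1) h y) \<le> fact 1 * (C * \<delta>) / (R/2) ^ 1"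
      proof (rule Cauchy_inequality)
        show "h holomorphic_on ball y (R/2)" unfolding h_def
          by (intro holomorphic_intros holomorphic_on_subset[OF hol]) auto
        show "continuous_on (cball y (R/2)) h" unfolding h_def
          by (intro holomorphic_on_imp_continuous_on holomorphic_intros holomorphic_on_subset[OF hol]) auto
        fix x assume x: "cmod (y - x) = R/2"
        have "cmod (x - z) \<le> cmod (y - x) + cmod (y - z)"
          using norm_triangle_ineq[of "x - y" "y - z"] by (simp add: norm_minus_commute)
        also have "\<dots> \<le> R" using x y r by (simp add: dist_norm norm_minus_commute)
        finally show "cmod (h x) \<le> C * \<delta>" unfolding h_def using bound \<delta> \<delta>1 by simp
      qed (use \<open>R > 0\<close> in auto)
      moreover have "deriv h y = deriv (f \<delta>) y - deriv (f 0) y" unfolding h_def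
        using DERIV_imp_deriv[OF DERIV_diff[OF der der]] by blast
      ultimately have "cmod (deriv (f \<delta>) y - deriv (f 0) y) \<le> C * \<delta> * 2 / R" by simp
      also have "\<dots> \<le> cmod D / 4" using C\<delta> \<open>R > 0\<close> by (simp add: field_simps)
      finally have "cmod (deriv (f \<delta>) y - deriv (f 0) y) \<le> cmod D / 4" .
      moreover have "cmod (deriv (f 0) y - D) \<le> cmod D / 4"
        using d(2)[of y] y r by (simp add: dist_norm norm_minus_commute)
      ultimately show ?thesis
        using norm_triangle_ineq[of "deriv (f \<delta>) y - deriv (f 0) y" "deriv (f 0) y - D"] by simp
    qed
    have lip: "dist (g x) (g y) \<le> 1/2 * dist x y" if "x \<in> cball z r" "y \<in> cball z r" for x y
      unfolding dist_norm
    proof (rule field_differentiable_bound)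
      fix w assume w: "w \<in> cball z r"
      show "(g has_field_derivative (1 - deriv (f \<delta>) w / D)) (at w within cball z r)"
        unfolding g_def by (rule has_field_derivative_at_within) (auto intro!: derivative_eq_intros der simp: D0)
      have "1 - deriv (f \<delta>) w / D = - ((deriv (f \<delta>) w - D) / D)" using D0 by (simp add: field_simps)
      then show "cmod (1 - deriv (f \<delta>) w / D) \<le> 1/2"
        using dd[OF w] D by (simp add: norm_divide divide_le_eq)
    qed (use that in auto)
    have gz: "dist z (g z) \<le> C * \<delta> / cmod D"
      using bound[of \<delta> z] zero \<delta> \<delta>1 \<open>R > 0\<close> D by (simp add: g_def dist_norm norm_divide field_simps)
    also have "\<dots> \<le> r / 2" using C\<delta> D by (simp add: field_simps)
    finally have "\<exists>!x. x \<in> cball z r \<and> g x = x"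
      using Banach_fix_cball[of r z g] lip r by simp
    then obtain y where y: "y \<in> cball z r" "g y = y" "\<And>y'. y' \<in> cball z r \<Longrightarrow> g y' = y' \<Longrightarrow> y' = y" by blast
    \<comment> \<open>The contraction absorbs half of \<open>dist z y\<close> on the right, which is
      where the factor 2 in the constant \<open>2 * C / cmod D\<close> comes from.\<close>
    have "dist z y \<le> dist z (g z) + dist (g z) (g y)" using y(2) dist_triangle[of z y "g z"] by simp
    also have "dist (g z) (g y) \<le> 1/2 * dist z y" using lip[of z y] y(1) r(1) by simp
    finally have "dist z y \<le> 2 * C / cmod D * \<delta>" using gz by simp
    then have "f \<delta> y = 0 \<and> cmod (y - z) \<le> 2 * C / cmod D * \<delta> \<and> cmod (y - z) \<le> r"
      using y(1,2) unfolding fixed by (simp add: dist_norm norm_minus_commute)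
    moreover have "y' = y" if "cmod (y' - z) \<le> r" "f \<delta> y' = 0" for y'
      using y(3)[of y'] that unfolding fixed by (simp add: dist_norm norm_minus_commute)
    ultimately show ?thesis by blast
  qed
  have "\<forall>\<^sub>F \<delta> in at_right 0. 0 < \<delta> \<and> \<delta> < \<eta>"
    using \<eta> by (auto simp: eventually_at_right_field)
  hence "\<forall>\<^sub>F \<delta> in at_right 0. \<exists>y. f \<delta> y = 0 \<and> cmod (y - z) \<le> 2 * C / cmod D * \<delta> \<and>
           cmod (y - z) \<le> r \<and> (\<forall>y'. cmod (y' - z) \<le> r \<longrightarrow> f \<delta> y' = 0 \<longrightarrow> y' = y)"
    by (rule eventually_mono) (use main in blast)
  then show ?thesis using r by blast
qed

section \<open>The fundamental system\<close>

text \<open>With \<open>sink\<close>, the solutions of u'' + c u = 0 with Cauchy data (1, 0) and (0,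
  1) at t = 0. The parameter is c and not the wave number, because both are entire in c and c = 0,
  the static case, is included.\<close>

definition cosk :: "complex \<Rightarrow> real \<Rightarrow> complex" where
  "cosk c t = cos (csqrt c * of_real t)"

definition sink :: "complex \<Rightarrow> real \<Rightarrow> complex" where
  "sink c t = (if c = 0 then of_real t else sin (csqrt c * of_real t) / csqrt c)"

lemma cosk_0 [simp]: "cosk c 0 = 1" "cosk 0 t = 1"
  and sink_0 [simp]: "sink c 0 = 0" "sink 0 t = of_real t"
  by (simp_all add: cosk_def sink_def)

lemma csqrt_sq: "csqrt c * csqrt c = c"
  by (metis power2_csqrt power2_eq_square)

lemma cosk_sink_id: "cosk c t * cosk c t + c * (sink c t * sink c t) = 1"
proof (cases "c = 0")
  case False
  have "c * (sink c t * sink c t) = (sin (csqrt c * of_real t))\<^sup>2"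
    using False csqrt_sq[of c] by (simp add: sink_def power2_eq_square field_simps)
  then show ?thesis by (simp add: cosk_def flip: power2_eq_square)
qed simp

lemma cosk_vderiv: "((\<lambda>x. cosk c (x - a)) has_vector_derivative - (c * sink c (x - a))) (at x)"
proof -
  have "((\<lambda>z. cos (csqrt c * (z - of_real a))) has_field_derivative
     - sin (csqrt c * (of_real x - of_real a)) * csqrt c) (at (of_real x))"
    by (auto intro!: derivative_eq_intros)
  from has_vector_derivative_real_field[OF this]
  moreover have "- sin (csqrt c * (of_real x - of_real a)) * csqrt c = - (c * sink c (x - a))"
    using csqrt_sq[of c] by (auto simp: sink_def field_simps)
  ultimately show ?thesis by (simp add: cosk_def)
qed

lemma sink_vderiv: "((\<lambda>x. sink c (x - a)) has_vector_derivative cosk c (x - a)) (at x)"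
proof (cases "c = 0")
  case True
  then show ?thesis by (auto simp: cosk_def sink_def intro!: derivative_eq_intros)
next
  case False
  have "((\<lambda>z. sin (csqrt c * (z - of_real a)) / csqrt c) has_field_derivative
     cos (csqrt c * (of_real x - of_real a))) (at (of_real x))"
    using False by (auto intro!: derivative_eq_intros)
  from has_vector_derivative_real_field[OF this]
  show ?thesis using False by (auto simp: cosk_def sink_def)
qed

lemma entire_powser:
  fixes f :: "complex \<Rightarrow> complex"
  assumes "\<And>c. (\<lambda>n. a n * c ^ n) sums f c"
  shows "f holomorphic_on UNIV"
proof -
  have "((\<lambda>x. \<Sum>n. a n * x^n) has_field_derivative (\<Sum>n. diffs a n * x^n)) (at x)" for x
    by (rule termdiffs_strong_converges_everywhere) (use assms sums_summable in blast)
  moreover have "(\<lambda>x. \<Sum>n. a n * x^n) = f" using assms by (auto simp: sums_iff)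
  ultimately show ?thesis
    by (metis field_differentiable_def field_differentiable_at_within holomorphic_onI)
qed

text \<open>The square root is cut along a ray, but the cosine series contains only its even powers,
  i.e. powers of c. For \<open>sink\<close> the odd powers become even after division by
  \<open>csqrt c\<close>.\<close>

lemma cosk_holomorphic: "(\<lambda>c. cosk c t) holomorphic_on UNIV"
proof (rule entire_powser)
  fix c
  have "(\<lambda>n. cos_coeff (2 * n) *\<^sub>R (csqrt c * of_real t) ^ (2 * n)) sums cosk c t"
    unfolding cosk_def using cos_converges[of "csqrt c * of_real t"]
    by (subst sums_mono_reindex[where f = "\<lambda>n. cos_coeff n *\<^sub>R (csqrt c * of_real t) ^ n"])
       (auto simp: strict_mono_def cos_coeff_def elim!: evenE)
  moreover have "(csqrt c) ^ (2 * n) = c ^ n" for n by (simp add: power_mult)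
  ultimately show "(\<lambda>n. of_real (cos_coeff (2 * n) * t ^ (2 * n)) * c ^ n) sums cosk c t"
    by (simp add: scaleR_conv_of_real power_mult_distrib mult_ac)
qed

lemma sink_holomorphic: "(\<lambda>c. sink c t) holomorphic_on UNIV"
proof (rule entire_powser)
  fix c
  let ?a = "\<lambda>n. complex_of_real (sin_coeff (2 * n + 1) * t ^ (2 * n + 1))"
  show "(\<lambda>n. ?a n * c ^ n) sums sink c t"
  proof (cases "c = 0")
    case True
    have "(\<lambda>n. ?a n * 0 ^ n) sums ?a 0" by (rule powser_sums_zero)
    then show ?thesis using True by (simp add: sin_coeff_def)
  next
    case False
    have "(\<lambda>n. sin_coeff (2 * n + 1) *\<^sub>R (csqrt c * of_real t) ^ (2 * n + 1)) sums sin (csqrt c * of_real t)"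
      using sin_converges[of "csqrt c * of_real t"]
      by (subst sums_mono_reindex[where f = "\<lambda>n. sin_coeff n *\<^sub>R (csqrt c * of_real t) ^ n"])
         (auto simp: strict_mono_def sin_coeff_def elim!: oddE)
    from sums_divide[OF this, of "csqrt c"]
    moreover have "sin_coeff (2 * n + 1) *\<^sub>R (csqrt c * of_real t) ^ (2 * n + 1) / csqrt c = ?a n * c ^ n" for n
    proof -
      have "(csqrt c) ^ (2 * n + 1) = c ^ n * csqrt c" by (simp add: power_mult)
      then show ?thesis using False by (simp add: scaleR_conv_of_real power_mult_distrib)
    qed
    ultimately show ?thesis using False by (simp add: sink_def)
  qed
qed

lemma entire_lipschitz:
  fixes f :: "complex \<Rightarrow> complex"
  assumes "f holomorphic_on UNIV"
  shows "\<exists>K\<ge>0. \<forall>c. cmod c \<le> R \<longrightarrow> cmod (f c - f 0) \<le> K * cmod c"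
proof -
  have "continuous_on (cball 0 R) (deriv f)"
    using holomorphic_deriv[OF assms] holomorphic_on_imp_continuous_on continuous_on_subset by blast
  then have "bounded (deriv f ` cball 0 R)"
    by (intro compact_imp_bounded compact_continuous_image) auto
  then obtain K where K: "K > 0" "\<And>c. c \<in> cball 0 R \<Longrightarrow> cmod (deriv f c) \<le> K"
    unfolding bounded_pos by auto
  have "cmod (f c - f 0) \<le> K * cmod (c - 0)" if "cmod c \<le> R" for c
  proof (rule field_differentiable_bound[where S = "cball 0 R" and f' = "deriv f"])
    fix z show "(f has_field_derivative deriv f z) (at z within cball 0 R)"
      using assms by (simp add: holomorphic_derivI)
    have "0 \<le> R" using that norm_ge_zero[of c] by linarith
    then show "0 \<in> cball (0::complex) R" by simp
  qed (use that K in auto)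
  then show ?thesis using K by (intro exI[of _ K]) auto
qed

section \<open>Transfer matrices\<close>

datatype mat2 = Mat2 (e11: complex) (e12: complex) (e21: complex) (e22: complex)

definition mul2 :: "mat2 \<Rightarrow> mat2 \<Rightarrow> mat2" where
  "mul2 A B = Mat2 (e11 A * e11 B + e12 A * e21 B) (e11 A * e12 B + e12 A * e22 B)
                   (e21 A * e11 B + e22 A * e21 B) (e21 A * e12 B + e22 A * e22 B)"

definition det2 :: "mat2 \<Rightarrow> complex" where "det2 A = e11 A * e22 A - e12 A * e21 A"
definition tr2 :: "mat2 \<Rightarrow> complex" where "tr2 A = e11 A + e22 A"

primrec prod2 :: "(nat \<Rightarrow> mat2) \<Rightarrow> nat \<Rightarrow> mat2" where
  "prod2 M 0 = Mat2 1 0 0 1"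
| "prod2 M (Suc n) = mul2 (M n) (prod2 M n)"

lemma det2_mul2: "det2 (mul2 A B) = det2 A * det2 B"
  by (simp add: det2_def mul2_def algebra_simps)

lemma det2_prod2: "(\<And>i. i < n \<Longrightarrow> det2 (M i) = 1) \<Longrightarrow> det2 (prod2 M n) = 1"
  by (induction n) (simp_all add: det2_mul2, simp add: det2_def)

text \<open>With determinant 1 the characteristic equation is k^2 - k tr A + 1 = 0; division by k
  leaves a condition on the trace alone.\<close>

lemma unimodular_eigenvalue_iff:
  assumes "det2 A = 1" and k: "k \<noteq> 0"
  shows "(\<exists>p q. (p, q) \<noteq> (0, 0) \<and> e11 A * p + e12 A * q = k * p \<and> e21 A * p + e22 A * q = k * q)
     \<longleftrightarrow> tr2 A = k + 1 / k"
proof -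
  have char: "(e11 A - k) * (e22 A - k) = e12 A * e21 A \<longleftrightarrow> tr2 A = k + 1 / k"
  proof -
    have "(e11 A - k) * (e22 A - k) - e12 A * e21 A = 1 - k * tr2 A + k * k"
      using assms(1) by (simp add: det2_def tr2_def algebra_simps)
    moreover have "1 - k * tr2 A + k * k = 0 \<longleftrightarrow> tr2 A = k + 1 / k"
      using k by (auto simp: field_simps)
    ultimately show ?thesis by (metis eq_iff_diff_eq_0)
  qed
  show ?thesis
  proof
    assume "\<exists>p q. (p, q) \<noteq> (0, 0) \<and> e11 A * p + e12 A * q = k * p \<and> e21 A * p + e22 A * q = k * q"
    then obtain p q where pq: "(p, q) \<noteq> (0, 0)" "e11 A * p + e12 A * q = k * p" "e21 A * p + e22 A * q = k * q"
      by blast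
    have x: "(e11 A - k) * p = - (e12 A * q)" "(e22 A - k) * q = - (e21 A * p)"
      using pq(2,3) by (simp_all add: algebra_simps)
    have "((e11 A - k) * (e22 A - k) - e12 A * e21 A) * p = (e22 A - k) * ((e11 A - k) * p) - e12 A * (e21 A * p)"
      by (simp add: algebra_simps)
    also have "\<dots> = - (e12 A * ((e22 A - k) * q)) - e12 A * (e21 A * p)" unfolding x(1) by (simp add: algebra_simps)
    also have "\<dots> = 0" unfolding x(2) by simp
    finally have 1: "((e11 A - k) * (e22 A - k) - e12 A * e21 A) * p = 0" .
    have "((e11 A - k) * (e22 A - k) - e12 A * e21 A) * q = (e11 A - k) * ((e22 A - k) * q) - e21 A * (e12 A * q)"
      by (simp add: algebra_simps)
    also have "\<dots> = - (e21 A * ((e11 A - k) * p)) - e21 A * (e12 A * q)" unfolding x(2) by (simp add: algebra_simps)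
    also have "\<dots> = 0" unfolding x(1) by simp
    finally have "((e11 A - k) * (e22 A - k) - e12 A * e21 A) * q = 0" .
    with 1 have "(e11 A - k) * (e22 A - k) = e12 A * e21 A" using pq(1) by auto
    then show "tr2 A = k + 1 / k" using char by simp
  next
    assume "tr2 A = k + 1 / k"
    then have c: "(e11 A - k) * (e22 A - k) = e12 A * e21 A" using char by simp
    \<comment> \<open>Both (e12, k - e11) and (k - e22, e21) are annihilated by the singular matrix
      A - k. They vanish together only if A is k times the identity, and then every vector
      serves.\<close>
    consider "e12 A \<noteq> 0 \<or> e11 A \<noteq> k" | "e22 A \<noteq> k \<or> e21 A \<noteq> 0"
      | "e12 A = 0" "e11 A = k" "e22 A = k" "e21 A = 0" by blast
    then show "\<exists>p q. (p, q) \<noteq> (0, 0) \<and> e11 A * p + e12 A * q = k * p \<and> e21 A * p + e22 A * q = k * q"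
    proof cases
      case 1
      have "e21 A * e12 A + e22 A * (k - e11 A) = k * (k - e11 A)" using c by (simp add: algebra_simps)
      then show ?thesis using 1 by (intro exI[of _ "e12 A"] exI[of _ "k - e11 A"]) (auto simp: algebra_simps)
    next
      case 2
      have "e11 A * (k - e22 A) + e12 A * e21 A = k * (k - e22 A)" using c by (simp add: algebra_simps)
      then show ?thesis using 2 by (intro exI[of _ "k - e22 A"] exI[of _ "e21 A"]) (auto simp: algebra_simps)
    next
      case 3
      then show ?thesis by (intro exI[of _ 1] exI[of _ 0]) auto
    qed
  qed
qed

text \<open>The entries of a product are polynomials in the entries of the factors. \<open>Q\<close>
  will be continuity, \<open>lipschitz_at_0\<close> and holomorphy, so the induction is done once
  for all three.\<close>

lemma prod2_closed:
  fixes M :: "'x \<Rightarrow> nat \<Rightarrow> mat2"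
  assumes "\<And>f g. Q f \<Longrightarrow> Q g \<Longrightarrow> Q (\<lambda>x. f x + g x)" "\<And>f g. Q f \<Longrightarrow> Q g \<Longrightarrow> Q (\<lambda>x. f x * g x)"
    and "Q (\<lambda>_. 0)" "Q (\<lambda>_. 1)"
    and "\<And>i. Q (\<lambda>x. e11 (M x i)) \<and> Q (\<lambda>x. e12 (M x i)) \<and> Q (\<lambda>x. e21 (M x i)) \<and> Q (\<lambda>x. e22 (M x i))"
  shows "Q (\<lambda>x. e11 (prod2 (M x) n)) \<and> Q (\<lambda>x. e12 (prod2 (M x) n)) \<and>
         Q (\<lambda>x. e21 (prod2 (M x) n)) \<and> Q (\<lambda>x. e22 (prod2 (M x) n))"
proof (induction n)
  case 0
  show ?case using assms(3,4) by simp
next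
  case (Suc n)
  note E = conjunct1[OF assms(5)] conjunct1[OF conjunct2[OF assms(5)]]
    conjunct1[OF conjunct2[OF conjunct2[OF assms(5)]]] conjunct2[OF conjunct2[OF conjunct2[OF assms(5)]]]
  note P = conjunct1[OF Suc] conjunct1[OF conjunct2[OF Suc]]
    conjunct1[OF conjunct2[OF conjunct2[OF Suc]]] conjunct2[OF conjunct2[OF conjunct2[OF Suc]]]
  show ?case unfolding prod2.simps mul2_def mat2.sel by (intro conjI assms(1,2) E P)
qed

text \<open>For \<open>a = 1\<close>, \<open>b = w\<^sup>2/\<delta>\<close>, \<open>k0 = 1/v\<^sup>2\<close>, \<open>k = 1/v\<^sub>i\<^sup>2\<close> and \<open>z = w\<^sup>2\<close> this maps the pair
  (value, outer derivative) at a left end point to the same pair at the next left end point; the inner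
  derivative is \<open>\<delta>\<close> times the outer one.  Homogeneity in \<open>(a, b)\<close> gives access to
  the regime \<open>w\<^sup>2/\<delta> \<rightarrow> \<infinity>\<close>.\<close>

definition cell :: "complex \<Rightarrow> complex \<Rightarrow> complex \<Rightarrow> complex \<Rightarrow> complex \<Rightarrow> real \<Rightarrow> real \<Rightarrow> real \<Rightarrow> mat2" where
  "cell k0 k a b z \<delta> l s =
     mul2 (Mat2 (cosk (k0 * z) s) (sink (k0 * z) s) (- (k0 * z) * sink (k0 * z) s) (cosk (k0 * z) s))
          (Mat2 (a * cosk (k * z) l) (a * of_real \<delta> * sink (k * z) l) (- (b * k) * sink (k * z) l) (a * cosk (k * z) l))"

definition monodromy ::
  "complex \<Rightarrow> (nat \<Rightarrow> complex) \<Rightarrow> (nat \<Rightarrow> real) \<Rightarrow> (nat \<Rightarrow> real) \<Rightarrow> nat \<Rightarrow> complex \<Rightarrow> complex \<Rightarrow> complex \<Rightarrow> real \<Rightarrow> mat2" where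
  "monodromy k0 k l s n a b z \<delta> = prod2 (\<lambda>i. cell k0 (k i) a b z \<delta> (l i) (s i)) n"

text \<open>The coupling z = \<delta> \<mu> matters: the off-diagonal entries of the resonator
  factor carry \<delta> and \<mu>, and their product is then the z needed for
  \<open>cosk_sink_id\<close>.\<close>

lemma det_monodromy: "det2 (monodromy k0 k l s n 1 \<mu> (of_real \<delta> * \<mu>) \<delta>) = 1"
  unfolding monodromy_def
proof (rule det2_prod2)
  fix i
  define C S C' S' where "C = cosk (k0 * (of_real \<delta> * \<mu>)) (s i)" and "S = sink (k0 * (of_real \<delta> * \<mu>)) (s i)"
    and "C' = cosk (k i * (of_real \<delta> * \<mu>)) (l i)" and "S' = sink (k i * (of_real \<delta> * \<mu>)) (l i)"
  have "C * C + k0 * (of_real \<delta> * \<mu>) * (S * S) = 1" "C' * C' + k i * (of_real \<delta> * \<mu>) * (S' * S') = 1"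
    unfolding C_def S_def C'_def S'_def by (rule cosk_sink_id)+
  then have "det2 (Mat2 C S (- (k0 * (of_real \<delta> * \<mu>)) * S) C) = 1"
      "det2 (Mat2 (1 * C') (1 * of_real \<delta> * S') (- (\<mu> * k i) * S') (1 * C')) = 1"
    by (simp_all add: det2_def mult_ac)
  then show "det2 (cell k0 (k i) 1 \<mu> (of_real \<delta> * \<mu>) \<delta> (l i) (s i)) = 1"
    unfolding cell_def det2_mul2 C_def S_def C'_def S'_def by simp
qed

text \<open>Each resonator factor is linear in (a, b) and the background factor is free of them, so
  each cell contributes one power of c.\<close>

lemma monodromy_homogeneous:
  assumes "c \<noteq> 0"
  shows "tr2 (monodromy k0 k l s n (c * a) (c * b) z \<delta>) = c ^ n * tr2 (monodromy k0 k l s n a b z \<delta>)"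
proof -
  let ?A = "monodromy k0 k l s n a b z \<delta>" and ?B = "monodromy k0 k l s n (c * a) (c * b) z \<delta>"
  have "e11 ?B = c ^ n * e11 ?A \<and> e12 ?B = c ^ n * e12 ?A \<and> e21 ?B = c ^ n * e21 ?A \<and> e22 ?B = c ^ n * e22 ?A"
    unfolding monodromy_def by (induction n) (simp_all add: mul2_def cell_def algebra_simps)
  then show ?thesis by (simp add: tr2_def algebra_simps)
qed

text \<open>For a = z = \<delta> = 0 and b = 1 the second column of every cell vanishes, so the
  upper left entries simply multiply. By homogeneity this is the coefficient of \<mu>^n in the limit
  polynomial. For n = 0 the product is the identity, with trace 2.\<close>

lemma tr_monodromy_leading:
  assumes "n > 0"
  shows "tr2 (monodromy k0 k l s n 0 1 0 0) = (\<Prod>i<n. - (k i * of_real (l i) * of_real (s i)))"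
proof -
  let ?A = "monodromy k0 k l s n 0 1 0 0"
  have "e11 ?A = (\<Prod>i<n. - (k i * of_real (l i) * of_real (s i))) \<and> e12 ?A = 0 \<and> (n > 0 \<longrightarrow> e22 ?A = 0)"
    unfolding monodromy_def by (induction n) (simp_all add: mul2_def cell_def)
  then show ?thesis using assms by (simp add: tr2_def)
qed

text \<open>At z = \<delta> = 0 the entries of a cell are affine in \<mu>. Because the degree bound
  rises by one with every factor, the induction is direct instead of through
  \<open>prod2_closed\<close>, whose property is fixed.\<close>

lemma tr_monodromy_poly:
  "\<exists>p. degree p \<le> n \<and> (\<forall>\<mu>. tr2 (monodromy k0 k l s n 1 \<mu> 0 0) = poly p \<mu>)"
proof -
  define Q where "Q m f \<longleftrightarrow> (\<exists>p. degree p \<le> m \<and> f = poly p)" for m and f :: "complex \<Rightarrow> complex"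
  have add: "Q m (\<lambda>x. f x + g x)" if "Q m f" "Q m g" for m f g
    using that unfolding Q_def by (metis (no_types, lifting) degree_add_le ext poly_add)
  have mult: "Q (m + m') (\<lambda>x. f x * g x)" if fg: "Q m f" "Q m' g" for m m' f g
  proof -
    obtain p p' where "degree p \<le> m" "f = poly p" "degree p' \<le> m'" "g = poly p'" using fg unfolding Q_def by blast
    then show ?thesis unfolding Q_def
      by (intro exI[of _ "p * p'"]) (auto intro: order_trans[OF degree_mult_le])
  qed
  have lin: "Q 1 (\<lambda>x. c + d * x)" for c d
    unfolding Q_def by (intro exI[of _ "[:c, d:]"]) (auto simp: mult.commute)
  have const: "Q m (\<lambda>x. c)" for m c
    unfolding Q_def by (intro exI[of _ "[:c:]"]) auto
  let ?A = "\<lambda>\<mu>. monodromy k0 k l s n 1 \<mu> 0 0"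
  have "Q n (\<lambda>\<mu>. e11 (?A \<mu>)) \<and> Q n (\<lambda>\<mu>. e12 (?A \<mu>)) \<and> Q n (\<lambda>\<mu>. e21 (?A \<mu>)) \<and> Q n (\<lambda>\<mu>. e22 (?A \<mu>))"
    unfolding monodromy_def
  proof (induction n)
    case 0
    show ?case by (simp add: const)
  next
    case (Suc n)
    let ?c = "\<lambda>\<mu>. cell k0 (k n) 1 \<mu> 0 0 (l n) (s n)"
    have c: "e11 (?c \<mu>) = 1 + (- (of_real (s n) * k n * of_real (l n))) * \<mu>" "e12 (?c \<mu>) = of_real (s n) + 0 * \<mu>"
        "e21 (?c \<mu>) = 0 + (- (k n * of_real (l n))) * \<mu>" "e22 (?c \<mu>) = 1 + 0 * \<mu>" for \<mu>
      by (simp_all add: cell_def mul2_def)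
    have "Q (Suc n) (\<lambda>x. (c + d * x) * f x + (c' + d' * x) * g x)" if "Q n f" "Q n g" for c d c' d' f g
      using add[OF mult[OF lin that(1)] mult[OF lin that(2)]] by simp
    then show ?case using Suc unfolding prod2.simps mul2_def mat2.sel c by blast
  qed
  then have "Q n (\<lambda>\<mu>. tr2 (?A \<mu>))" unfolding tr2_def
    using add[of n "\<lambda>\<mu>. e11 (?A \<mu>)" "\<lambda>\<mu>. e22 (?A \<mu>)"] by blast
  then show ?thesis unfolding Q_def by (metis (no_types, lifting))
qed

section \<open>Dependence of the trace on its parameters: continuity, first-order bounds in
  \<delta>, holomorphy in \<mu>\<close>

lemma continuous_entire_compose:
  assumes "f holomorphic_on UNIV" "continuous_on UNIV g"
  shows "continuous_on UNIV (\<lambda>x. f (g x))"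
  using continuous_on_compose2[OF holomorphic_on_imp_continuous_on[OF assms(1)] assms(2)] by simp

text \<open>In the coordinates a = 1/\<mu>, z = w^2 and \<delta>, taken as independent, the regime
  of infinite \<mu> with vanishing w and \<delta> becomes the single point (0, 0, 0).\<close>

lemma tr_monodromy_continuous:
  "continuous_on UNIV (\<lambda>(a, z, \<delta>). tr2 (monodromy k0 k l s n a 1 z \<delta>))"
proof -
  let ?M = "\<lambda>x i. cell k0 (k i) (fst x) 1 (fst (snd x)) (snd (snd x)) (l i) (s i)"
  have ck: "continuous_on UNIV (\<lambda>x::complex \<times> complex \<times> real. cosk (c * fst (snd x)) t)" "continuous_on UNIV (\<lambda>x::complex \<times> complex \<times> real. sink (c * fst (snd x)) t)" for c t
    by (intro continuous_entire_compose[OF cosk_holomorphic] continuous_entire_compose[OF sink_holomorphic] continuous_intros)+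
  have "continuous_on UNIV (\<lambda>x. e11 (prod2 (?M x) n)) \<and> continuous_on UNIV (\<lambda>x. e12 (prod2 (?M x) n)) \<and>
        continuous_on UNIV (\<lambda>x. e21 (prod2 (?M x) n)) \<and> continuous_on UNIV (\<lambda>x. e22 (prod2 (?M x) n))"
    by (rule prod2_closed[where Q = "continuous_on UNIV"]; (unfold cell_def mul2_def mat2.sel)?; intro conjI ck continuous_intros)
  then show ?thesis
    unfolding case_prod_beta' tr2_def monodromy_def by (intro continuous_on_add) blast+
qed

text \<open>The bound \<open>B\<close> on the values is carried along because the estimate for a
  product requires it. \<open>B\<close> and \<open>C\<close> are uniform over the disc of
  \<mu>.\<close>

definition lipschitz_at_0 :: "real \<Rightarrow> (real \<times> complex \<Rightarrow> complex) \<Rightarrow> bool" where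
  "lipschitz_at_0 R f \<longleftrightarrow> (\<exists>B C. 0 \<le> B \<and> 0 \<le> C \<and> (\<forall>\<delta> \<mu>. 0 \<le> \<delta> \<longrightarrow> \<delta> \<le> 1 \<longrightarrow> cmod \<mu> \<le> R \<longrightarrow>
     cmod (f (\<delta>, \<mu>)) \<le> B \<and> cmod (f (\<delta>, \<mu>) - f (0, \<mu>)) \<le> C * \<delta>))"

lemma lipschitz_at_0I:
  assumes "0 \<le> B" "0 \<le> C"
    and "\<And>\<delta> \<mu>. 0 \<le> \<delta> \<Longrightarrow> \<delta> \<le> 1 \<Longrightarrow> cmod \<mu> \<le> R \<Longrightarrow>
      cmod (f (\<delta>, \<mu>)) \<le> B \<and> cmod (f (\<delta>, \<mu>) - f (0, \<mu>)) \<le> C * \<delta>"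
  shows "lipschitz_at_0 R f"
  unfolding lipschitz_at_0_def using assms by blast

lemma lipschitz_at_0E:
  assumes "lipschitz_at_0 R f"
  obtains B C where "0 \<le> B" "0 \<le> C"
    "\<And>\<delta> \<mu>. 0 \<le> \<delta> \<Longrightarrow> \<delta> \<le> 1 \<Longrightarrow> cmod \<mu> \<le> R \<Longrightarrow>
      cmod (f (\<delta>, \<mu>)) \<le> B \<and> cmod (f (\<delta>, \<mu>) - f (0, \<mu>)) \<le> C * \<delta>"
  using assms unfolding lipschitz_at_0_def by blast

lemma lipschitz_at_0_add:
  assumes "lipschitz_at_0 R f" "lipschitz_at_0 R g"
  shows "lipschitz_at_0 R (\<lambda>x. f x + g x)"
proof -
  obtain B C where f: "0 \<le> B" "0 \<le> C"
    "\<And>\<delta> \<mu>. 0 \<le> \<delta> \<Longrightarrow> \<delta> \<le> 1 \<Longrightarrow> cmod \<mu> \<le> R \<Longrightarrow> cmod (f (\<delta>, \<mu>)) \<le> B \<and> cmod (f (\<delta>, \<mu>) - f (0, \<mu>)) \<le> C * \<delta>"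
    by (rule lipschitz_at_0E[OF assms(1)]) (rule that; assumption)
  obtain B' C' where g: "0 \<le> B'" "0 \<le> C'"
    "\<And>\<delta> \<mu>. 0 \<le> \<delta> \<Longrightarrow> \<delta> \<le> 1 \<Longrightarrow> cmod \<mu> \<le> R \<Longrightarrow> cmod (g (\<delta>, \<mu>)) \<le> B' \<and> cmod (g (\<delta>, \<mu>) - g (0, \<mu>)) \<le> C' * \<delta>"
    by (rule lipschitz_at_0E[OF assms(2)]) (rule that; assumption)
  have "cmod (f (\<delta>, \<mu>) + g (\<delta>, \<mu>)) \<le> B + B' \<and> cmod (f (\<delta>, \<mu>) + g (\<delta>, \<mu>) - (f (0, \<mu>) + g (0, \<mu>))) \<le> (C + C') * \<delta>"
    if d: "0 \<le> \<delta>" "\<delta> \<le> 1" "cmod \<mu> \<le> R" for \<delta> \<mu>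
    using f(3)[OF d] g(3)[OF d] norm_triangle_ineq[of "f (\<delta>, \<mu>)" "g (\<delta>, \<mu>)"]
      norm_triangle_ineq[of "f (\<delta>, \<mu>) - f (0, \<mu>)" "g (\<delta>, \<mu>) - g (0, \<mu>)"]
    by (simp add: algebra_simps)
  then show ?thesis using f(1,2) g(1,2) by (intro lipschitz_at_0I[of "B + B'" "C + C'"]) simp_all
qed

lemma lipschitz_at_0_mult:
  assumes "lipschitz_at_0 R f" "lipschitz_at_0 R g"
  shows "lipschitz_at_0 R (\<lambda>x. f x * g x)"
proof -
  obtain B C where f: "0 \<le> B" "0 \<le> C"
    "\<And>\<delta> \<mu>. 0 \<le> \<delta> \<Longrightarrow> \<delta> \<le> 1 \<Longrightarrow> cmod \<mu> \<le> R \<Longrightarrow> cmod (f (\<delta>, \<mu>)) \<le> B \<and> cmod (f (\<delta>, \<mu>) - f (0, \<mu>)) \<le> C * \<delta>"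
    by (rule lipschitz_at_0E[OF assms(1)]) (rule that; assumption)
  obtain B' C' where g: "0 \<le> B'" "0 \<le> C'"
    "\<And>\<delta> \<mu>. 0 \<le> \<delta> \<Longrightarrow> \<delta> \<le> 1 \<Longrightarrow> cmod \<mu> \<le> R \<Longrightarrow> cmod (g (\<delta>, \<mu>)) \<le> B' \<and> cmod (g (\<delta>, \<mu>) - g (0, \<mu>)) \<le> C' * \<delta>"
    by (rule lipschitz_at_0E[OF assms(2)]) (rule that; assumption)
  have "cmod (f (\<delta>, \<mu>) * g (\<delta>, \<mu>)) \<le> B * B' \<and> cmod (f (\<delta>, \<mu>) * g (\<delta>, \<mu>) - f (0, \<mu>) * g (0, \<mu>)) \<le> (B * C' + C * B') * \<delta>"
    if d: "0 \<le> \<delta>" "\<delta> \<le> 1" "cmod \<mu> \<le> R" for \<delta> \<mu>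
  proof
    have d0: "(0::real) \<le> 0" "(0::real) \<le> 1" "cmod \<mu> \<le> R" using d by auto
    show "cmod (f (\<delta>, \<mu>) * g (\<delta>, \<mu>)) \<le> B * B'"
      unfolding norm_mult using f(3)[OF d] g(3)[OF d] f(1,2) g(1,2) by (intro mult_mono) auto
    have t1: "cmod (f (\<delta>, \<mu>) * (g (\<delta>, \<mu>) - g (0, \<mu>))) \<le> B * (C' * \<delta>)"
      unfolding norm_mult using f(3)[OF d] g(3)[OF d] f(1,2) g(1,2) by (intro mult_mono) auto
    have t2: "cmod ((f (\<delta>, \<mu>) - f (0, \<mu>)) * g (0, \<mu>)) \<le> (C * \<delta>) * B'"
      unfolding norm_mult using f(3)[OF d] g(3)[OF d0] f(1,2) g(1,2) d by (intro mult_mono) auto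
    have e1: "f (\<delta>, \<mu>) * g (\<delta>, \<mu>) - f (0, \<mu>) * g (0, \<mu>) =
        f (\<delta>, \<mu>) * (g (\<delta>, \<mu>) - g (0, \<mu>)) + (f (\<delta>, \<mu>) - f (0, \<mu>)) * g (0, \<mu>)" by (simp add: algebra_simps)
    have e2: "(B * C' + C * B') * \<delta> = B * (C' * \<delta>) + (C * \<delta>) * B'" by (simp add: algebra_simps)
    show "cmod (f (\<delta>, \<mu>) * g (\<delta>, \<mu>) - f (0, \<mu>) * g (0, \<mu>)) \<le> (B * C' + C * B') * \<delta>"
      unfolding e1 e2 using t1 t2 norm_triangle_ineq[of "f (\<delta>, \<mu>) * (g (\<delta>, \<mu>) - g (0, \<mu>))" "(f (\<delta>, \<mu>) - f (0, \<mu>)) * g (0, \<mu>)"]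
      by linarith
  qed
  moreover have "0 \<le> B * B'" "0 \<le> B * C' + C * B'" using f(1,2) g(1,2) by simp_all
  ultimately show ?thesis by (intro lipschitz_at_0I[of "B * B'" "B * C' + C * B'"])
qed

lemma lipschitz_at_0_const: "lipschitz_at_0 R (\<lambda>_. c)"
  unfolding lipschitz_at_0_def by (intro exI[of _ "cmod c"] exI[of _ 0]) auto

lemma lipschitz_at_0_snd: "lipschitz_at_0 R snd"
proof (cases "0 \<le> R")
  case True
  then show ?thesis unfolding lipschitz_at_0_def by (intro exI[of _ R] exI[of _ 0]) auto
next
  case False
  then have "\<not> cmod \<mu> \<le> R" for \<mu> using norm_ge_zero[of \<mu>] by linarith
  then show ?thesis unfolding lipschitz_at_0_def by auto
qed

lemma lipschitz_at_0_fst: "lipschitz_at_0 R (\<lambda>x. of_real (fst x))"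
  unfolding lipschitz_at_0_def by (intro exI[of _ 1]) auto

lemma lipschitz_at_0_entire:
  assumes "f holomorphic_on UNIV"
  shows "lipschitz_at_0 R (\<lambda>x. f (c * (of_real (fst x) * snd x)))"
proof -
  obtain K where K: "K \<ge> 0" "\<And>z. cmod z \<le> cmod c * R \<Longrightarrow> cmod (f z - f 0) \<le> K * cmod z"
    using entire_lipschitz[OF assms] by blast
  \<comment> \<open>The absolute value keeps the constants nonnegative when R < 0, where no \<mu>
    qualifies.\<close>
  have "cmod (f (c * (of_real \<delta> * \<mu>))) \<le> cmod (f 0) + K * (cmod c * \<bar>R\<bar>) \<and>
      cmod (f (c * (of_real \<delta> * \<mu>)) - f (c * (of_real 0 * \<mu>))) \<le> (K * (cmod c * \<bar>R\<bar>)) * \<delta>"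
    if d: "0 \<le> \<delta>" "\<delta> \<le> 1" "cmod \<mu> \<le> R" for \<delta> \<mu>
  proof -
    have R: "R \<ge> 0" using d(3) norm_ge_zero[of \<mu>] by linarith
    have le: "cmod (c * (of_real \<delta> * \<mu>)) \<le> cmod c * (\<delta> * R)"
      using d by (auto simp: norm_mult intro!: mult_left_mono)
    have "\<delta> * R \<le> 1 * R" using d R by (intro mult_right_mono) auto
    then have le1: "cmod c * (\<delta> * R) \<le> cmod c * R" by (intro mult_left_mono) auto
    have "cmod (f (c * (of_real \<delta> * \<mu>)) - f 0) \<le> K * cmod (c * (of_real \<delta> * \<mu>))"
      using le le1 by (intro K(2)) simp
    also have "\<dots> \<le> K * (cmod c * (\<delta> * R))" using le K(1) by (rule mult_left_mono)
    finally have A: "cmod (f (c * (of_real \<delta> * \<mu>)) - f 0) \<le> K * (cmod c * (\<delta> * R))" .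
    also have "\<dots> \<le> K * (cmod c * R)" using le1 K(1) by (rule mult_left_mono)
    finally have "cmod (f (c * (of_real \<delta> * \<mu>)) - f 0) \<le> K * (cmod c * R)" .
    then have "cmod (f (c * (of_real \<delta> * \<mu>))) \<le> cmod (f 0) + K * (cmod c * R)"
      using norm_triangle_ineq[of "f (c * (of_real \<delta> * \<mu>)) - f 0" "f 0"] by simp
    then show ?thesis using A R by (simp add: mult_ac)
  qed
  moreover have "0 \<le> K * (cmod c * \<bar>R\<bar>)" using K(1) by simp
  ultimately show ?thesis
    by (intro lipschitz_at_0I[of "cmod (f 0) + K * (cmod c * \<bar>R\<bar>)" "K * (cmod c * \<bar>R\<bar>)"]) simp_all
qed

lemma tr_monodromy_lipschitz:
  "lipschitz_at_0 R (\<lambda>(\<delta>, \<mu>). tr2 (monodromy k0 k l s n 1 \<mu> (of_real \<delta> * \<mu>) \<delta>))"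
proof -
  let ?M = "\<lambda>x i. cell k0 (k i) 1 (snd x) (of_real (fst x) * snd x) (fst x) (l i) (s i)"
  let ?Q = "lipschitz_at_0 R"
  have minus: "?Q (\<lambda>x. - f x)" if "?Q f" for f
    using lipschitz_at_0_mult[OF lipschitz_at_0_const[of R "- 1"] that] by simp
  have diff: "?Q (\<lambda>x. f x - g x)" if "?Q f" "?Q g" for f g
    using lipschitz_at_0_add[OF that(1) minus[OF that(2)]] by simp
  note I = diff lipschitz_at_0_add lipschitz_at_0_mult lipschitz_at_0_const lipschitz_at_0_snd lipschitz_at_0_fst
    lipschitz_at_0_entire[OF cosk_holomorphic] lipschitz_at_0_entire[OF sink_holomorphic] minus
  have "?Q (\<lambda>x. e11 (prod2 (?M x) n)) \<and> ?Q (\<lambda>x. e12 (prod2 (?M x) n)) \<and>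
        ?Q (\<lambda>x. e21 (prod2 (?M x) n)) \<and> ?Q (\<lambda>x. e22 (prod2 (?M x) n))"
    by (rule prod2_closed[where Q = ?Q]; (unfold cell_def mul2_def mat2.sel)?; intro conjI I)
  then have A: "?Q (\<lambda>x. e11 (prod2 (?M x) n))" and B: "?Q (\<lambda>x. e22 (prod2 (?M x) n))" by blast+
  show ?thesis
    unfolding case_prod_beta' tr2_def monodromy_def by (rule lipschitz_at_0_add[OF A B])
qed

lemma tr_monodromy_holomorphic:
  "(\<lambda>\<mu>. tr2 (monodromy k0 k l s n 1 \<mu> (of_real \<delta> * \<mu>) \<delta>)) holomorphic_on UNIV"
proof -
  let ?M = "\<lambda>\<mu> i. cell k0 (k i) 1 \<mu> (of_real \<delta> * \<mu>) \<delta> (l i) (s i)"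
  let ?Q = "\<lambda>f. f holomorphic_on (UNIV :: complex set)"
  have ck: "?Q (\<lambda>\<mu>. cosk (c * (of_real \<delta> * \<mu>)) t)" "?Q (\<lambda>\<mu>. sink (c * (of_real \<delta> * \<mu>)) t)" for c t
    using holomorphic_on_compose_gen[OF _ cosk_holomorphic, of "\<lambda>\<mu>. c * (of_real \<delta> * \<mu>)" UNIV]
      holomorphic_on_compose_gen[OF _ sink_holomorphic, of "\<lambda>\<mu>. c * (of_real \<delta> * \<mu>)" UNIV]
    by (simp_all add: o_def holomorphic_intros)
  have "?Q (\<lambda>x. e11 (prod2 (?M x) n)) \<and> ?Q (\<lambda>x. e12 (prod2 (?M x) n)) \<and>
        ?Q (\<lambda>x. e21 (prod2 (?M x) n)) \<and> ?Q (\<lambda>x. e22 (prod2 (?M x) n))"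
    by (rule prod2_closed[where Q = ?Q]; (unfold cell_def mul2_def mat2.sel)?; intro conjI ck holomorphic_intros)
  then show ?thesis
    unfolding tr2_def monodromy_def by (intro holomorphic_on_add) blast+
qed

section \<open>Zeros of the discriminant\<close>

text \<open>Counted with multiplicity there are at most \<open>degree p\<close> roots, and the
  points of \<open>A\<close> already use up this number.\<close>

lemma poly_simple_roots:
  fixes p :: "complex poly"
  assumes "p \<noteq> 0" "degree p \<le> card A" "finite A" "\<And>x. x \<in> A \<Longrightarrow> poly p x = 0"
  shows "{x. poly p x = 0} = A" and "x \<in> A \<Longrightarrow> poly (pderiv p) x \<noteq> 0"
proof -
  have fin: "finite {x. poly p x = 0}" using assms(1) by (rule poly_roots_finite)
  have "card {x. poly p x = 0} \<le> card A" using card_poly_roots_bound[OF assms(1)] assms(2) by linarith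
  then show roots: "{x. poly p x = 0} = A"
    using card_seteq[OF fin, of A] assms(4) by auto
  show "poly (pderiv p) x \<noteq> 0" if "x \<in> A"
  proof
    assume "poly (pderiv p) x = 0"
    have px: "poly p x = 0" using assms(4) that by simp
    then have "degree p \<noteq> 0" using assms(1) by (metis degree_0_id poly_const_conv degree_eq_zeroE pCons_0_0)
    then have dp: "pderiv p \<noteq> 0" by (simp add: pderiv_eq_0_iff)
    then have "order x (pderiv p) \<noteq> 0" using \<open>poly (pderiv p) x = 0\<close> by (simp add: order_root)
    then have two: "order x p \<ge> 2" using order_pderiv[OF assms(1) px] by simp
    have set: "set_mset (proots p) = A" using roots assms(1) by simp
    \<comment> \<open>A multiple root at x would be counted once as a point of \<open>A\<close> and
      once more, giving more than \<open>degree p\<close> roots.\<close>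
    have "mset_set A + {#x#} \<subseteq># proots p"
    proof (rule mset_subset_eqI)
      fix z
      have "count (mset_set A) z \<le> (if z \<in> A then 1 else 0)" using assms(3) by simp
      moreover have "z \<in> A \<Longrightarrow> order z p \<ge> 1" using assms(1,4) order_root[of p z] by (simp add: Suc_le_eq)
      ultimately show "count (mset_set A + {#x#}) z \<le> count (proots p) z"
        using two that assms(1) by (auto split: if_splits)
    qed
    then have "card A + 1 \<le> size (proots p)" using size_mset_mono by fastforce
    also have "\<dots> \<le> degree p" by (rule size_proots_le)
    finally show False using assms(2) by simp
  qed
qed

text \<open>The restriction in the completeness clause is on \<delta> \<mu> = w^2 and not on \<mu>,
  with \<eta> independent of \<delta>; it therefore captures every w tending to 0, however
  slowly.\<close>

lemma discriminant_roots:
  fixes lam :: "nat \<Rightarrow> complex" and T k0 :: complex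
  assumes n: "n > 0" and nz: "\<And>i. i < n \<Longrightarrow> k i \<noteq> 0 \<and> l i \<noteq> 0 \<and> s i \<noteq> 0"
    and inj: "inj_on lam {1..n}"
    and F: "\<And>\<delta> \<mu>. F \<delta> \<mu> = tr2 (monodromy k0 k l s n 1 \<mu> (of_real \<delta> * \<mu>) \<delta>) - T"
    and zero: "\<And>i. i \<in> {1..n} \<Longrightarrow> F 0 (lam i) = 0"
  shows "\<exists>y \<eta>. 0 < \<eta> \<and>
     (\<forall>i\<in>{1..n}. \<exists>K. \<forall>\<^sub>F \<delta> in at_right 0. F \<delta> (y i \<delta>) = 0 \<and> cmod (y i \<delta> - lam i) \<le> K * \<delta>) \<and>
     (\<forall>\<^sub>F \<delta> in at_right 0. \<forall>\<mu>. cmod (of_real \<delta> * \<mu>) < \<eta> \<longrightarrow> F \<delta> \<mu> = 0 \<longrightarrow> (\<exists>i\<in>{1..n}. \<mu> = y i \<delta>))"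
proof -
  \<comment> \<open>The discriminant in coordinates at infinity: F \<delta> \<mu> = \<mu>^n
    H(1/\<mu>, \<delta> \<mu>, \<delta>), which turns the constant T into T a^n.\<close>
  define H where "H = (\<lambda>(a, z, \<delta>). tr2 (monodromy k0 k l s n a 1 z \<delta>) - T * a ^ n)"
  have "continuous_on UNIV (\<lambda>x. (\<lambda>(a, z, \<delta>). tr2 (monodromy k0 k l s n a 1 z \<delta>)) x - T * fst x ^ n)"
    by (intro continuous_intros tr_monodromy_continuous)
  moreover have "(\<lambda>x. (\<lambda>(a, z, \<delta>). tr2 (monodromy k0 k l s n a 1 z \<delta>)) x - T * fst x ^ n) = H"
    by (auto simp: H_def)
  ultimately have contH: "continuous_on UNIV H" by (simp only:)
  have "H (0, 0, 0) = (\<Prod>i<n. - (k i * of_real (l i) * of_real (s i)))"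
    using n by (simp add: H_def tr_monodromy_leading)
  also have "\<dots> \<noteq> 0" using nz by auto
  finally have H0: "H (0, 0, 0) \<noteq> 0" .
  have "open {x. H x \<noteq> 0}" using contH by (intro open_Collect_neq) auto
  then obtain e where e: "e > 0" "ball (0, 0, 0) e \<subseteq> {x. H x \<noteq> 0}"
    using H0 open_contains_ball by blast
  define \<eta> where "\<eta> = e / 4"
  have \<eta>: "\<eta> > 0" using e by (simp add: \<eta>_def)
  have Hnz: "H (a, z, \<delta>) \<noteq> 0" if "cmod a \<le> \<eta>" "cmod z \<le> \<eta>" "\<bar>\<delta>\<bar> \<le> \<eta>" for a z \<delta>
  proof -
    have "norm (a, z, \<delta>) \<le> cmod a + (cmod z + norm \<delta>)"
      using norm_Pair_le[of a "(z, \<delta>)"] norm_Pair_le[of z \<delta>] by linarith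
    also have "\<dots> < e" using that e by (simp add: \<eta>_def)
    finally have "(a, z, \<delta>) \<in> ball (0, 0, 0) e" by (simp flip: zero_prod_def)
    then show ?thesis using e by blast
  qed
  define R where "R = 1 / \<eta>"
  have R: "R > 0" using \<eta> by (simp add: R_def)
  have large: "F \<delta> \<mu> \<noteq> 0" if "R \<le> cmod \<mu>" "cmod (of_real \<delta> * \<mu>) \<le> \<eta>" "\<bar>\<delta>\<bar> \<le> \<eta>" for \<delta> \<mu>
  proof -
    have mu: "\<mu> \<noteq> 0" using that R by auto
    have "cmod (1 / \<mu>) \<le> \<eta>" using that(1) mu \<eta> by (simp add: R_def norm_divide field_simps)
    then have "H (1 / \<mu>, of_real \<delta> * \<mu>, \<delta>) \<noteq> 0" using that by (intro Hnz)
    moreover have "F \<delta> \<mu> = \<mu> ^ n * H (1 / \<mu>, of_real \<delta> * \<mu>, \<delta>)"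
      using monodromy_homogeneous[OF mu, of k0 k l s n "1/\<mu>" 1 "of_real \<delta> * \<mu>" \<delta>] mu
      by (simp add: F H_def right_diff_distrib power_one_over)
    ultimately show ?thesis using mu by simp
  qed
  obtain p0 where p0: "degree p0 \<le> n" "\<And>\<mu>. tr2 (monodromy k0 k l s n 1 \<mu> 0 0) = poly p0 \<mu>"
    using tr_monodromy_poly by blast
  define p where "p = p0 - [:T:]"
  have p: "F 0 = poly p" using p0 by (auto simp: F p_def)
  have degp: "degree p \<le> card (lam ` {1..n})"
    using p0 inj by (simp add: p_def card_image degree_diff_le)
  \<comment> \<open>Root counting requires a nonzero polynomial, which the exclusion of large zeros
    supplies at \<delta> = 0.\<close>
  have "F 0 (of_real R) \<noteq> 0" using large[of "of_real R" 0] R \<eta> by simp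
  then have pnz: "p \<noteq> 0" using p by auto
  have zl: "poly p x = 0" if "x \<in> lam ` {1..n}" for x using that zero p by auto
  have roots: "{x. poly p x = 0} = lam ` {1..n}"
    using poly_simple_roots(1)[OF pnz degp _ zl] by simp
  have simple: "poly (pderiv p) (lam i) \<noteq> 0" if "i \<in> {1..n}" for i
    using poly_simple_roots(2)[OF pnz degp _ zl] that by simp
  have hol: "F \<delta> holomorphic_on UNIV" for \<delta>
  proof -
    have "F \<delta> = (\<lambda>\<mu>. tr2 (monodromy k0 k l s n 1 \<mu> (of_real \<delta> * \<mu>) \<delta>) - T)" by (auto simp: F)
    then show ?thesis using holomorphic_on_diff[OF tr_monodromy_holomorphic holomorphic_on_const] by simp
  qed
  have lip: "\<exists>C\<ge>0. \<forall>\<delta> \<mu>. 0 \<le> \<delta> \<longrightarrow> \<delta> \<le> 1 \<longrightarrow> cmod \<mu> \<le> R' \<longrightarrow> cmod (F \<delta> \<mu> - F 0 \<mu>) \<le> C * \<delta>" for R'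
    using tr_monodromy_lipschitz[of R' k0 k l s n] unfolding lipschitz_at_0_def by (auto simp: F)
  have "\<exists>r K y. 0 < r \<and> (\<forall>\<^sub>F \<delta> in at_right 0. F \<delta> (y \<delta>) = 0 \<and> cmod (y \<delta> - lam i) \<le> K * \<delta> \<and>
      (\<forall>y'. cmod (y' - lam i) \<le> r \<longrightarrow> F \<delta> y' = 0 \<longrightarrow> y' = y \<delta>))" if i: "i \<in> {1..n}" for i
  proof -
    obtain C where C: "C \<ge> 0" "\<And>\<delta> \<mu>. 0 \<le> \<delta> \<Longrightarrow> \<delta> \<le> 1 \<Longrightarrow> cmod \<mu> \<le> cmod (lam i) + 1 \<Longrightarrow> cmod (F \<delta> \<mu> - F 0 \<mu>) \<le> C * \<delta>"
      using lip by blast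
    have "deriv (F 0) (lam i) \<noteq> 0" using simple[OF i] p DERIV_imp_deriv[OF poly_DERIV] by metis
    moreover have "cmod (F \<delta> y - F 0 y) \<le> C * \<delta>" if "0 \<le> \<delta>" "\<delta> \<le> 1" "cmod (y - lam i) \<le> 1" for \<delta> y
      using C(2)[OF that(1,2)] that(3) norm_triangle_ineq[of "y - lam i" "lam i"] by simp
    ultimately obtain r K where rK: "0 < r" "\<forall>\<^sub>F \<delta> in at_right 0. \<exists>y. F \<delta> y = 0 \<and> cmod (y - lam i) \<le> K * \<delta> \<and>
           cmod (y - lam i) \<le> r \<and> (\<forall>y'. cmod (y' - lam i) \<le> r \<longrightarrow> F \<delta> y' = 0 \<longrightarrow> y' = y)"
      using simple_zero_perturbation[of F "lam i" 1 C, OF hol zero[OF i]] C(1) by auto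
    \<comment> \<open>The choice is made for each \<delta> separately, without continuity in
      \<delta>; it is meaningful only for the small \<delta> at which such a zero exists.\<close>
    define y where "y \<delta> = (SOME y. F \<delta> y = 0 \<and> cmod (y - lam i) \<le> K * \<delta> \<and>
           cmod (y - lam i) \<le> r \<and> (\<forall>y'. cmod (y' - lam i) \<le> r \<longrightarrow> F \<delta> y' = 0 \<longrightarrow> y' = y))" for \<delta>
    have "\<forall>\<^sub>F \<delta> in at_right 0. F \<delta> (y \<delta>) = 0 \<and> cmod (y \<delta> - lam i) \<le> K * \<delta> \<and>
      (\<forall>y'. cmod (y' - lam i) \<le> r \<longrightarrow> F \<delta> y' = 0 \<longrightarrow> y' = y \<delta>)"
      using rK(2)
    proof (rule eventually_mono)
      fix \<delta> assume "\<exists>y. F \<delta> y = 0 \<and> cmod (y - lam i) \<le> K * \<delta> \<and>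
           cmod (y - lam i) \<le> r \<and> (\<forall>y'. cmod (y' - lam i) \<le> r \<longrightarrow> F \<delta> y' = 0 \<longrightarrow> y' = y)"
      from someI_ex[OF this, folded y_def] show "F \<delta> (y \<delta>) = 0 \<and> cmod (y \<delta> - lam i) \<le> K * \<delta> \<and>
        (\<forall>y'. cmod (y' - lam i) \<le> r \<longrightarrow> F \<delta> y' = 0 \<longrightarrow> y' = y \<delta>)" by blast
    qed
    then show ?thesis using rK(1) by blast
  qed
  then have "\<forall>i\<in>{1..n}. \<exists>r K y. 0 < r \<and> (\<forall>\<^sub>F \<delta> in at_right 0. F \<delta> (y \<delta>) = 0 \<and> cmod (y \<delta> - lam i) \<le> K * \<delta> \<and>
      (\<forall>y'. cmod (y' - lam i) \<le> r \<longrightarrow> F \<delta> y' = 0 \<longrightarrow> y' = y \<delta>))" by (rule ballI)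
  from bchoice[OF this] obtain r where "\<forall>i\<in>{1..n}. \<exists>K y. 0 < r i \<and> (\<forall>\<^sub>F \<delta> in at_right 0. F \<delta> (y \<delta>) = 0 \<and> cmod (y \<delta> - lam i) \<le> K * \<delta> \<and>
      (\<forall>y'. cmod (y' - lam i) \<le> r i \<longrightarrow> F \<delta> y' = 0 \<longrightarrow> y' = y \<delta>))" ..
  from bchoice[OF this] obtain K where "\<forall>i\<in>{1..n}. \<exists>y. 0 < r i \<and> (\<forall>\<^sub>F \<delta> in at_right 0. F \<delta> (y \<delta>) = 0 \<and> cmod (y \<delta> - lam i) \<le> K i * \<delta> \<and>
      (\<forall>y'. cmod (y' - lam i) \<le> r i \<longrightarrow> F \<delta> y' = 0 \<longrightarrow> y' = y \<delta>))" ..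
  from bchoice[OF this] obtain y where y': "\<forall>i\<in>{1..n}. 0 < r i \<and> (\<forall>\<^sub>F \<delta> in at_right 0. F \<delta> (y i \<delta>) = 0 \<and> cmod (y i \<delta> - lam i) \<le> K i * \<delta> \<and>
      (\<forall>y'. cmod (y' - lam i) \<le> r i \<longrightarrow> F \<delta> y' = 0 \<longrightarrow> y' = y i \<delta>))" ..
  have y: "0 < r i" "\<forall>\<^sub>F \<delta> in at_right 0. F \<delta> (y i \<delta>) = 0 \<and> cmod (y i \<delta> - lam i) \<le> K i * \<delta> \<and>
      (\<forall>y'. cmod (y' - lam i) \<le> r i \<longrightarrow> F \<delta> y' = 0 \<longrightarrow> y' = y i \<delta>)" if "i \<in> {1..n}" for i
    using y' that by blast+
  \<comment> \<open>Off the discs where Newton's map guarantees uniqueness, the limit polynomial has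
    no zero in this compact set and so stays above some m > 0 in modulus.\<close>
  define S where "S = cball 0 R - (\<Union>i\<in>{1..n}. ball (lam i) (r i))"
  have "compact S" unfolding S_def by (intro compact_diff compact_cball open_UN) auto
  then have "compact (poly p ` S)" by (intro compact_continuous_image continuous_intros)
  moreover have "0 \<notin> poly p ` S"
  proof
    assume "0 \<in> poly p ` S"
    then obtain x where "x \<in> S" "poly p x = 0" by auto
    then obtain i where "i \<in> {1..n}" "x = lam i" using roots by blast
    then have "x \<in> ball (lam i) (r i)" using y(1) by simp
    then show False using \<open>x \<in> S\<close> \<open>i \<in> {1..n}\<close> unfolding S_def by blast
  qed
  ultimately have "\<exists>m>0. \<forall>x\<in>S. m \<le> cmod (poly p x)"
    using separate_point_closed[OF compact_imp_closed, of "poly p ` S" 0] by simp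
  then obtain m where m: "m > 0" "\<And>x. x \<in> S \<Longrightarrow> m \<le> cmod (poly p x)" by blast
  obtain C where C: "C \<ge> 0" "\<And>\<delta> \<mu>. 0 \<le> \<delta> \<Longrightarrow> \<delta> \<le> 1 \<Longrightarrow> cmod \<mu> \<le> R \<Longrightarrow> cmod (F \<delta> \<mu> - F 0 \<mu>) \<le> C * \<delta>"
    using lip by blast
  \<comment> \<open>\<open>m / (C + 1)\<close> makes the perturbation \<open>C * \<delta>\<close>
    smaller than the lower bound m on \<open>S\<close>; \<eta> is the range of \<delta> in which
    large \<mu> are excluded.\<close>
  define \<delta>0 where "\<delta>0 = min (min 1 \<eta>) (m / (C + 1))"
  have "\<delta>0 > 0" using \<eta> m C by (simp add: \<delta>0_def)
  then have ev: "\<forall>\<^sub>F \<delta> in at_right 0. 0 < \<delta> \<and> \<delta> < \<delta>0" by (auto simp: eventually_at_right_field)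
  have "\<forall>\<^sub>F \<delta> in at_right 0. \<forall>i\<in>{1..n}. F \<delta> (y i \<delta>) = 0 \<and> cmod (y i \<delta> - lam i) \<le> K i * \<delta> \<and>
      (\<forall>y'. cmod (y' - lam i) \<le> r i \<longrightarrow> F \<delta> y' = 0 \<longrightarrow> y' = y i \<delta>)"
    using y(2) by (intro eventually_ball_finite) auto
  with ev have "\<forall>\<^sub>F \<delta> in at_right 0. \<forall>\<mu>. cmod (of_real \<delta> * \<mu>) < \<eta> \<longrightarrow> F \<delta> \<mu> = 0 \<longrightarrow> (\<exists>i\<in>{1..n}. \<mu> = y i \<delta>)"
  proof eventually_elim
    case (elim \<delta>)
    show ?case
    proof (intro allI impI)
      fix \<mu> assume small: "cmod (of_real \<delta> * \<mu>) < \<eta>" and root: "F \<delta> \<mu> = 0"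
      have d: "0 < \<delta>" "\<delta> \<le> 1" "\<delta> \<le> \<eta>" "\<delta> < m / (C + 1)" using elim by (auto simp: \<delta>0_def)
      have muR: "cmod \<mu> \<le> R" using large[of \<mu> \<delta>] small root d by fastforce
      have "cmod (poly p \<mu>) \<le> C * \<delta>" using C(2)[of \<delta> \<mu>] muR d root p by simp
      also have "C * \<delta> < m" using d C(1) by (simp add: field_simps)
      finally have "\<mu> \<notin> S" using m(2)[of \<mu>] by auto
      then obtain i where "i \<in> {1..n}" "cmod (\<mu> - lam i) \<le> r i"
        using muR by (auto simp: S_def dist_norm norm_minus_commute)
      then show "\<exists>i\<in>{1..n}. \<mu> = y i \<delta>" using elim root by blast
    qed
  qed
  moreover have "\<exists>K. \<forall>\<^sub>F \<delta> in at_right 0. F \<delta> (y i \<delta>) = 0 \<and> cmod (y i \<delta> - lam i) \<le> K * \<delta>" if "i \<in> {1..n}" for i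
    using y(2)[OF that] by (intro exI[of _ "K i"]) (auto elim: eventually_mono)
  ultimately show ?thesis using \<eta> by blast
qed

section \<open>Solutions on an interval\<close>

text \<open>The solution of u'' + c u = 0 with value p and slope q at t = 0; \<open>dsol\<close> is
  its derivative.\<close>

definition sol :: "complex \<Rightarrow> complex \<Rightarrow> complex \<Rightarrow> real \<Rightarrow> complex" where
  "sol c p q t = p * cosk c t + q * sink c t"

definition dsol :: "complex \<Rightarrow> complex \<Rightarrow> complex \<Rightarrow> real \<Rightarrow> complex" where
  "dsol c p q t = q * cosk c t - c * (p * sink c t)"

lemma sol_0 [simp]: "sol c p q 0 = p" "dsol c p q 0 = q"
  by (simp_all add: sol_def dsol_def)

lemma sol_vderiv: "((\<lambda>x. sol c p q (x - a)) has_vector_derivative dsol c p q (x - a)) (at x)"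
  unfolding sol_def
  by (rule has_vector_derivative_eq_rhs[OF has_vector_derivative_add[OF
        has_vector_derivative_mult_right[OF cosk_vderiv] has_vector_derivative_mult_right[OF sink_vderiv]]])
     (simp add: dsol_def algebra_simps)

lemma dsol_vderiv: "((\<lambda>x. dsol c p q (x - a)) has_vector_derivative - (c * sol c p q (x - a))) (at x)"
  unfolding dsol_def
  by (rule has_vector_derivative_eq_rhs[OF has_vector_derivative_diff[OF
        has_vector_derivative_mult_right[OF cosk_vderiv]
        has_vector_derivative_mult_right[OF has_vector_derivative_mult_right[OF sink_vderiv]]]])
     (simp add: sol_def algebra_simps)

lemma sol_diff: "sol c (p - r * p') (q - r * q') t = sol c p q t - r * sol c p' q' t"
  by (simp add: sol_def algebra_simps)

lemma sol_scale: "sol c (r * p) (r * q) t = r * sol c p q t" "dsol c (r * p) (r * q) t = r * dsol c p q t"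
  by (simp_all add: sol_def dsol_def algebra_simps)

lemma sol_continuous: "continuous_on A (\<lambda>x. sol c p q (x - a))"
  by (intro continuous_at_imp_continuous_on ballI) (rule has_vector_derivative_continuous[OF sol_vderiv])

lemma constant_on_interval:
  fixes f :: "real \<Rightarrow> complex"
  assumes "\<And>x. x \<in> {a<..<b} \<Longrightarrow> (f has_vector_derivative 0) (at x)"
  shows "\<exists>c. \<forall>x\<in>{a<..<b}. f x = c"
proof (rule has_derivative_zero_constant)
  fix x assume "x \<in> {a<..<b}"
  from assms[OF this] show "(f has_derivative (\<lambda>h. 0)) (at x within {a<..<b})"
    by (simp add: has_vector_derivative_def has_derivative_at_withinI)
qed simp

text \<open>Pairing a solution with the fundamental system gives two conserved quantities, which are its Cauchy data.\<close>

lemma helmholtz_representation: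
  fixes u :: "real \<Rightarrow> complex"
  assumes "a < b" and cont: "continuous_on {a..b} u" and h: "helmholtz_on {a<..<b} c u"
  shows "\<exists>p q. \<forall>x\<in>{a..b}. u x = sol c p q (x - a)"
proof -
  have u': "(u has_vector_derivative vderiv u x) (at x)"
       "(vderiv u has_vector_derivative - (c * u x)) (at x)" if "x \<in> {a<..<b}" for x
    using h that by (auto simp: helmholtz_on_def vector_derivative_works)
  have "((\<lambda>x. u x * cosk c (x - a) - vderiv u x * sink c (x - a)) has_vector_derivative 0) (at x)"
    if x: "x \<in> {a<..<b}" for x
    by (rule has_vector_derivative_eq_rhs[OF has_vector_derivative_diff[OF
          has_vector_derivative_mult[OF u'(1)[OF x] cosk_vderiv]
          has_vector_derivative_mult[OF u'(2)[OF x] sink_vderiv]]])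
       (simp add: algebra_simps)
  then obtain p where p: "\<And>x. x \<in> {a<..<b} \<Longrightarrow> u x * cosk c (x - a) - vderiv u x * sink c (x - a) = p"
    using constant_on_interval[of a b "\<lambda>x. u x * cosk c (x - a) - vderiv u x * sink c (x - a)"] by blast
  have "((\<lambda>x. c * (u x * sink c (x - a)) + vderiv u x * cosk c (x - a)) has_vector_derivative 0) (at x)"
    if x: "x \<in> {a<..<b}" for x
    by (rule has_vector_derivative_eq_rhs[OF has_vector_derivative_add[OF
          has_vector_derivative_mult_right[OF has_vector_derivative_mult[OF u'(1)[OF x] sink_vderiv]]
          has_vector_derivative_mult[OF u'(2)[OF x] cosk_vderiv]]])
       (simp add: algebra_simps)
  then obtain q where q: "\<And>x. x \<in> {a<..<b} \<Longrightarrow> c * (u x * sink c (x - a)) + vderiv u x * cosk c (x - a) = q"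
    using constant_on_interval[of a b "\<lambda>x. c * (u x * sink c (x - a)) + vderiv u x * cosk c (x - a)"] by blast
  have "u x - sol c p q (x - a) = 0" if x: "x \<in> {a<..<b}" for x
  proof -
    \<comment> \<open>Inserting the two conserved quantities cancels the terms with u' and leaves u
      times the unit determinant of the fundamental system.\<close>
    have "sol c p q (x - a) = u x * (cosk c (x - a) * cosk c (x - a) + c * (sink c (x - a) * sink c (x - a)))"
      unfolding sol_def p[OF x, symmetric] q[OF x, symmetric] by (simp add: algebra_simps)
    then show ?thesis by (simp add: cosk_sink_id)
  qed
  moreover have "closure {a<..<b} = {a..b}" using \<open>a < b\<close> by simp
  moreover have "continuous_on {a..b} (\<lambda>x. u x - sol c p q (x - a))"
    by (intro continuous_on_diff cont sol_continuous)
  ultimately have "u x - sol c p q (x - a) = 0" if "x \<in> {a..b}" for x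
    using continuous_constant_on_closure[of "{a<..<b}" "\<lambda>x. u x - sol c p q (x - a)" 0 x] that by simp
  then show ?thesis by auto
qed

context
  fixes u :: "real \<Rightarrow> complex" and a b :: real and c p q :: complex
  assumes ab: "a < b" and rep: "\<And>x. x \<in> {a..b} \<Longrightarrow> u x = sol c p q (x - a)"
begin

lemma represented_vderiv:
  assumes "x \<in> {a<..<b}"
  shows "(u has_vector_derivative dsol c p q (x - a)) (at x)"
  by (rule has_vector_derivative_transform_within_open[OF sol_vderiv open_greaterThanLessThan assms])
     (use rep in simp)

lemma represented_vderiv_eq: "x \<in> {a<..<b} \<Longrightarrow> vderiv u x = dsol c p q (x - a)"
  by (rule vector_derivative_at) (rule represented_vderiv)

lemma represented_helmholtz: "helmholtz_on {a<..<b} c u"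
  unfolding helmholtz_on_def
proof
  fix x assume x: "x \<in> {a<..<b}"
  have "(vderiv u has_vector_derivative - (c * sol c p q (x - a))) (at x)"
    by (rule has_vector_derivative_transform_within_open[OF dsol_vderiv open_greaterThanLessThan x])
       (simp add: represented_vderiv_eq)
  then have "(vderiv u has_vector_derivative - (c * u x)) (at x)"
    using rep[of x] x by simp
  then show "u differentiable at x \<and> (vderiv u has_vector_derivative - (c * u x)) (at x)"
    using represented_vderiv[OF x] differentiableI_vector by blast
qed

text \<open>Inside the interval \<open>vderiv u\<close> equals the continuous function
  \<open>dsol\<close>. The one-sided filters exclude the end point itself, where u may have a kink
  and \<open>vderiv\<close> carries no information.\<close>

lemma represented_limits: "(vderiv u \<longlongrightarrow> q) (at_right a)" "(vderiv u \<longlongrightarrow> dsol c p q (b - a)) (at_left b)"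
proof -
  have lim: "((\<lambda>x. dsol c p q (x - a)) \<longlongrightarrow> dsol c p q (y - a)) (at y within S)" for y S
    using has_vector_derivative_continuous[OF dsol_vderiv[of c p q a y]]
    by (metis continuous_at_imp_continuous_at_within continuous_within)
  have "\<forall>\<^sub>F x in at_right a. dsol c p q (x - a) = vderiv u x"
    unfolding eventually_at_right_field using ab represented_vderiv_eq by (intro exI[of _ b]) auto
  then show "(vderiv u \<longlongrightarrow> q) (at_right a)"
    using Lim_transform_eventually[OF lim[of a]] by simp
  have "\<forall>\<^sub>F x in at_left b. dsol c p q (x - a) = vderiv u x"
    unfolding eventually_at_left_field using ab represented_vderiv_eq by (intro exI[of _ a]) auto
  then show "(vderiv u \<longlongrightarrow> dsol c p q (b - a)) (at_left b)"
    using Lim_transform_eventually[OF lim[of b]] by simp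
qed

end

lemma sol_eq_0:
  assumes "b > 0" "\<And>t. t \<in> {0..b} \<Longrightarrow> sol c p q t = 0"
  shows "p = 0" "q = 0"
proof -
  show "p = 0" using assms(2)[of 0] assms(1) by simp
  have "(vderiv (\<lambda>_. 0) \<longlongrightarrow> q) (at_right 0)"
    using represented_limits(1)[of 0 b "\<lambda>_. 0" c p q] assms by simp
  then show "q = 0" using tendsto_const_iff[of "at_right (0::real)" 0 q] by simp
qed

text \<open>One passage across a resonator and the following gap. Multiplying g by \<delta> is the
  transmission condition on entering, dividing by \<delta> in q' the one on leaving.\<close>

lemma cell_step:
  fixes k0 k z p g :: complex and \<delta> l s :: real
  assumes "\<delta> \<noteq> 0"
  defines "A \<equiv> cell k0 k 1 (z / of_real \<delta>) z \<delta> l s"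
    and "p' \<equiv> sol (k * z) p (of_real \<delta> * g) l" and "q' \<equiv> dsol (k * z) p (of_real \<delta> * g) l / of_real \<delta>"
  shows "sol (k0 * z) p' q' s = e11 A * p + e12 A * g" "dsol (k0 * z) p' q' s = e21 A * p + e22 A * g"
  using assms(1) by (simp_all add: A_def p'_def q'_def cell_def mul2_def sol_def dsol_def field_simps)

lemma prod2_iterate:
  assumes "\<And>n. n < m \<Longrightarrow> p (Suc n) = e11 (M n) * p n + e12 (M n) * g n"
    and "\<And>n. n < m \<Longrightarrow> g (Suc n) = e21 (M n) * p n + e22 (M n) * g n"
  shows "p m = e11 (prod2 M m) * p 0 + e12 (prod2 M m) * g 0 \<and>
         g m = e21 (prod2 M m) * p 0 + e22 (prod2 M m) * g 0"
  using assms by (induction m) (simp_all add: mul2_def algebra_simps)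

section \<open>Periodic chains\<close>

locale chain =
  fixes N :: nat and L :: real and xL xR :: "int \<Rightarrow> real"
  assumes chain: "resonator_chain N L xL xR"
begin

lemma N_pos: "N > 0" and xL_1: "xL 1 = 0"
  and shift_N: "xL (i + int N) = xL i + L" "xR (i + int N) = xR i + L"
  using chain by (auto simp: resonator_chain_def)

lemma shift: "xL (i + m * int N) = xL i + of_int m * L" "xR (i + m * int N) = xR i + of_int m * L"
proof -
  have "xL (i + m * int N) = xL i + of_int m * L \<and> xR (i + m * int N) = xR i + of_int m * L"
  proof (induction m rule: int_induct[where k = 0])
    case (step1 m)
    then show ?case using shift_N[of "i + m * int N"] by (simp add: algebra_simps)
  next
    case (step2 m)
    then show ?case using shift_N[of "i + (m - 1) * int N"] by (simp add: algebra_simps)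
  qed simp
  then show "xL (i + m * int N) = xL i + of_int m * L" "xR (i + m * int N) = xR i + of_int m * L" by auto
qed

text \<open>Resonators are counted from 1, matrix rows from 0; the residue is taken from i - 1, so
  that \<open>res i\<close> is directly a matrix index and \<open>per i\<close> the number of whole
  periods to shift by.\<close>

definition res :: "int \<Rightarrow> nat" where "res i = nat ((i - 1) mod int N)"
definition per :: "int \<Rightarrow> int" where "per i = (i - 1) div int N"

lemma res_less: "res i < N"
  using N_pos by (simp add: res_def nat_less_iff)

lemma index_split: "i = int (res i) + 1 + per i * int N"
  using N_pos by (simp add: res_def per_def)

lemma res_per_eq: "r < N \<Longrightarrow> res (int r + 1 + m * int N) = r" "r < N \<Longrightarrow> per (int r + 1 + m * int N) = m"
  by (simp_all add: res_def per_def)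

lemma res_per_nat [simp]: "r < N \<Longrightarrow> res (int r + 1) = r" "r < N \<Longrightarrow> per (int r + 1) = 0"
  using res_per_eq[of r 0] by simp_all

lemma res_shift: "res (i + m * int N) = res i" and per_shift: "per (i + m * int N) = per i + m"
proof -
  have e: "i + m * int N - 1 = (i - 1) + m * int N" by simp
  show "res (i + m * int N) = res i" unfolding res_def e by (simp only: mod_mult_self1)
  have "int N \<noteq> 0" using N_pos by simp
  from div_mult_self1[OF this, of "i - 1" m] show "per (i + m * int N) = per i + m"
    unfolding per_def e by (simp only: add.commute)
qed

lemma index_cases:
  obtains (inner) "Suc (res i) < N" "res (i + 1) = Suc (res i)" "per (i + 1) = per i"
    | (wrap) "Suc (res i) = N" "res (i + 1) = 0" "per (i + 1) = per i + 1"
proof (cases "Suc (res i) < N")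
  case True
  have e: "i + 1 = int (Suc (res i)) + 1 + per i * int N" using index_split[of i] by simp
  show ?thesis
  proof (rule inner[OF True])
    show "res (i + 1) = Suc (res i)" by (subst e) (rule res_per_eq[OF True])
    show "per (i + 1) = per i" by (subst e) (rule res_per_eq[OF True])
  qed
next
  case False
  then have w: "Suc (res i) = N" using res_less[of i] by simp
  then have e: "i + 1 = int 0 + 1 + (per i + 1) * int N" using index_split[of i] by (simp add: algebra_simps)
  show ?thesis
  proof (rule wrap[OF w])
    show "res (i + 1) = 0" by (subst e) (rule res_per_eq[OF N_pos])
    show "per (i + 1) = per i + 1" by (subst e) (rule res_per_eq[OF N_pos])
  qed
qed

section \<open>Order of the end points and decomposition of the line into resonators and
  gaps\<close>

lemma left_less_right: "xL i < xR i"
proof -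
  have "xL (int (res i) + 1) < xR (int (res i) + 1)"
    using chain res_less[of i] by (auto simp: resonator_chain_def)
  then show ?thesis by (subst (1 2) index_split) (simp add: shift)
qed

lemma right_less_left: "xR i < xL (i + 1)"
proof -
  have "xR (int (res i) + 1) < xL (int (res i) + 1 + 1)"
  proof (cases "Suc (res i) < N")
    case True
    then have "int (res i) + 1 \<in> {1..<int N}" by auto
    then show ?thesis using chain unfolding resonator_chain_def by blast
  next
    case False
    then have "int (res i) + 1 = int N" using res_less[of i] by simp
    moreover have "xR (int N) < xL (1 + int N)" unfolding shift_N using chain by (simp add: resonator_chain_def)
    ultimately show ?thesis by (simp add: add.commute)
  qed
  moreover have "i + 1 = (int (res i) + 1 + 1) + per i * int N" using index_split[of i] by simp
  ultimately show ?thesis using index_split[of i] shift by (metis add_less_cancel_right)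
qed

lemma left_mono: "i < j \<Longrightarrow> xL i < xL j"
proof (induction j rule: int_gr_induct)
  case base
  then show ?case using left_less_right[of i] right_less_left[of i] by simp
next
  case (step j)
  then show ?case using left_less_right[of j] right_less_left[of j] by simp
qed

lemma left_mono_le: "i \<le> j \<Longrightarrow> xL i \<le> xL j"
  using left_mono[of i j] by (cases "i = j") auto

lemma L_pos: "L > 0"
  using left_mono[of 1 "1 + int N"] N_pos by (simp add: shift_N xL_1)

lemma cell_exists: "\<exists>i. xL i \<le> x \<and> x < xL (i + 1)"
proof -
  define m where "m = \<lfloor>x / L\<rfloor>"
  have m: "of_int m * L \<le> x" "x < (of_int m + 1) * L"
    using L_pos floor_divide_lower[of L x] floor_divide_upper[of L x] by (auto simp: m_def)
  \<comment> \<open>Since \<open>xL 1 = 0\<close>, the period containing x starts at an end point. A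
    discrete intermediate value argument along the N + 1 left end points from there finds the
    cell.\<close>
  define y where "y k = xL (1 + m * int N + int k)" for k
  have step: "y 0 \<le> x \<Longrightarrow> x < y n \<Longrightarrow> \<exists>k<n. y k \<le> x \<and> x < y (Suc k)" for n
  proof (induction n)
    case (Suc n)
    then show ?case by (cases "x < y n") (auto simp: less_Suc_eq not_less)
  qed simp
  have "y 0 \<le> x" using m shift[of 1 m] by (simp add: y_def xL_1)
  moreover have "1 + m * int N + int N = 1 + (m + 1) * int N" by (simp add: algebra_simps)
  then have "y N = xL (1 + (m + 1) * int N)" by (simp only: y_def)
  then have "x < y N" using m by (simp add: shift xL_1)
  ultimately obtain k where "y k \<le> x" "x < y (Suc k)" using step by blast
  then show ?thesis unfolding y_def by (intro exI[of _ "1 + m * int N + int k"]) (simp add: ac_simps)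
qed

lemma cell_unique:
  assumes "xL i \<le> x" "x < xL (i + 1)" "xL j \<le> x" "x < xL (j + 1)"
  shows "i = j"
proof (rule ccontr)
  assume "i \<noteq> j"
  then consider "i + 1 \<le> j" | "j + 1 \<le> i" by linarith
  then show False using left_mono_le[of "i + 1" j] left_mono_le[of "j + 1" i] assms by cases auto
qed

lemma piece_cases:
  obtains i where "xL i \<le> x" "x \<le> xR i" | i where "xR i < x" "x < xL (i + 1)"
  using cell_exists[of x] by (meson not_le)

text \<open>No closure of the infinite union is computed: an open gap that misses every resonator
  also misses their closure, and any point outside all gaps lies in some closed resonator.\<close>

lemma outside_eq: "- closure (resonators xL xR) = (\<Union>i. {xR i<..<xL (i + 1)})"
proof
  show "- closure (resonators xL xR) \<subseteq> (\<Union>i. {xR i<..<xL (i + 1)})"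
  proof
    fix x assume x: "x \<in> - closure (resonators xL xR)"
    have "{xL i..xR i} \<subseteq> closure (resonators xL xR)" for i
    proof -
      have "closure {xL i<..<xR i} \<subseteq> closure (resonators xL xR)"
        unfolding resonators_def by (intro closure_mono) auto
      then show ?thesis using left_less_right[of i] by simp
    qed
    then show "x \<in> (\<Union>i. {xR i<..<xL (i + 1)})"
      using x by (cases x rule: piece_cases) force+
  qed
  have disj: "{xR i<..<xL (i + 1)} \<inter> {xL j<..<xR j} = {}" for i j
  proof (cases "j \<le> i")
    case True
    then have "xR j \<le> xR i"
      using left_mono_le[of "j + 1" i] right_less_left[of j] left_less_right[of i] by (cases "j = i") auto
    then show ?thesis by auto
  next
    case False
    then show ?thesis using left_mono_le[of "i + 1" j] by auto
  qed
  have "{xR i<..<xL (i + 1)} \<inter> closure (resonators xL xR) = {}" for i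
    using disj unfolding open_Int_closure_eq_empty[OF open_greaterThanLessThan] resonators_def by blast
  then show "(\<Union>i. {xR i<..<xL (i + 1)}) \<subseteq> - closure (resonators xL xR)" by blast
qed

lemma translates_eq: "resonator_translates L xL xR i = (\<Union>m. {xL (i + m * int N)<..<xR (i + m * int N)})"
  by (simp add: resonator_translates_def shift)

text \<open>Encodes a function by its Cauchy data, (pI i, qI i) at \<open>xL i\<close> and (pO i, qO
  i) at \<open>xR i\<close>. The intervals are closed and share their end points, so continuity
  across them is built in.\<close>

definition piecewise ::
  "(int \<Rightarrow> complex) \<Rightarrow> complex \<Rightarrow> (int \<Rightarrow> complex) \<Rightarrow> (int \<Rightarrow> complex) \<Rightarrow> (int \<Rightarrow> complex) \<Rightarrow> (int \<Rightarrow> complex) \<Rightarrow>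
   (real \<Rightarrow> complex) \<Rightarrow> bool" where
  "piecewise ci co pI qI pO qO u \<longleftrightarrow>
     (\<forall>i. (\<forall>x\<in>{xL i..xR i}. u x = sol (ci i) (pI i) (qI i) (x - xL i)) \<and>
          (\<forall>x\<in>{xR i..xL (i + 1)}. u x = sol co (pO i) (qO i) (x - xR i)))"

lemma piecewise_exists:
  assumes "\<And>i. sol (ci i) (pI i) (qI i) (xR i - xL i) = pO i"
    and "\<And>i. sol co (pO i) (qO i) (xL (i + 1) - xR i) = pI (i + 1)"
  shows "\<exists>u. piecewise ci co pI qI pO qO u"
proof -
  define idx where "idx x = (SOME i. xL i \<le> x \<and> x < xL (i + 1))" for x
  have idx: "idx x = i" if "xL i \<le> x" "x < xL (i + 1)" for x i
    unfolding idx_def by (rule some_equality) (use that cell_unique in blast)+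
  define u where "u x = (let i = idx x in if x \<le> xR i then sol (ci i) (pI i) (qI i) (x - xL i)
      else sol co (pO i) (qO i) (x - xR i))" for x
  have inner: "u x = sol (ci i) (pI i) (qI i) (x - xL i)" if "x \<in> {xL i..xR i}" for x i
  proof -
    have "idx x = i" using that right_less_left[of i] by (intro idx) auto
    then show ?thesis using that by (simp add: u_def)
  qed
  moreover have "u x = sol co (pO i) (qO i) (x - xR i)" if x: "x \<in> {xR i..xL (i + 1)}" for x i
  proof -
    consider "x = xR i" | "x = xL (i + 1)" | "xR i < x" "x < xL (i + 1)" using x by fastforce
    then show ?thesis
    proof cases
      case 1
      then show ?thesis using inner[of x i] left_less_right[of i] assms(1) by simp
    next
      case 2
      then show ?thesis using inner[of x "i + 1"] left_less_right[of "i + 1"] assms(2) by simp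
    next
      case 3
      then have "idx x = i" using left_less_right[of i] by (intro idx) auto
      then show ?thesis using 3 by (simp add: u_def)
    qed
  qed
  ultimately show ?thesis unfolding piecewise_def by blast
qed

context
  fixes ci co pI qI pO qO u
  assumes pw: "piecewise ci co pI qI pO qO u"
begin

lemma piecewise_inner: "x \<in> {xL i..xR i} \<Longrightarrow> u x = sol (ci i) (pI i) (qI i) (x - xL i)"
  and piecewise_outer: "x \<in> {xR i..xL (i + 1)} \<Longrightarrow> u x = sol co (pO i) (qO i) (x - xR i)"
  using pw unfolding piecewise_def by blast+

lemma piecewise_endpoints:
  "u (xL i) = pI i" "u (xR i) = pO i"
  "pO i = sol (ci i) (pI i) (qI i) (xR i - xL i)" "pI (i + 1) = sol co (pO i) (qO i) (xL (i + 1) - xR i)"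
proof -
  have a: "u (xL i) = pI i" for i using piecewise_inner[of "xL i" i] left_less_right[of i] by simp
  have b: "u (xR i) = pO i" using piecewise_outer[of "xR i" i] right_less_left[of i] by simp
  show "u (xL i) = pI i" "u (xR i) = pO i" by (rule a, rule b)
  show "pO i = sol (ci i) (pI i) (qI i) (xR i - xL i)"
    using piecewise_inner[of "xR i" i] left_less_right[of i] b by simp
  show "pI (i + 1) = sol co (pO i) (qO i) (xL (i + 1) - xR i)"
    using piecewise_outer[of "xL (i + 1)" i] right_less_left[of i] a[of "i + 1"] by simp
qed

text \<open>An infinite union of closed pieces need not preserve continuity. Two neighbouring cells
  are glued first, giving an open interval around each \<open>xL i\<close>, and these open intervals
  cover the line.\<close>

lemma piecewise_continuous: "continuous_on UNIV u"
proof -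
  have I: "continuous_on {xL i..xR i} u" for i
    by (rule continuous_on_eq[OF sol_continuous]) (use piecewise_inner in auto)
  have O: "continuous_on {xR i..xL (i + 1)} u" for i
    by (rule continuous_on_eq[OF sol_continuous]) (use piecewise_outer in auto)
  have "continuous_on ({xL i..xR i} \<union> {xR i..xL (i + 1)}) u" for i
    by (intro continuous_on_closed_Un I O) auto
  moreover have "{xL i..xR i} \<union> {xR i..xL (i + 1)} = {xL i..xL (i + 1)}" for i
    using left_less_right[of i] right_less_left[of i] by auto
  ultimately have IO: "continuous_on {xL i..xL (i + 1)} u" for i by simp
  have "continuous_on ({xL (i - 1)..xL i} \<union> {xL i..xL (i + 1)}) u" for i
    using IO[of "i - 1"] IO[of i] by (intro continuous_on_closed_Un) auto
  moreover have "{xL (i - 1)<..<xL (i + 1)} \<subseteq> {xL (i - 1)..xL i} \<union> {xL i..xL (i + 1)}" for i by auto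
  ultimately have "continuous_on {xL (i - 1)<..<xL (i + 1)} u" for i using continuous_on_subset by blast
  then have "continuous_on (\<Union>i. {xL (i - 1)<..<xL (i + 1)}) u" by (intro continuous_on_open_UN) auto
  moreover have "(\<Union>i. {xL (i - 1)<..<xL (i + 1)}) = UNIV"
  proof -
    have "x \<in> (\<Union>i. {xL (i - 1)<..<xL (i + 1)})" for x
    proof -
      obtain i where "xL i \<le> x" "x < xL (i + 1)" using cell_exists by blast
      then have "x \<in> {xL (i - 1)<..<xL (i + 1)}" using left_mono[of "i - 1" i] by auto
      then show ?thesis by blast
    qed
    then show ?thesis by blast
  qed
  ultimately show ?thesis by simp
qed

lemma piecewise_helmholtz: "helmholtz_on {xL i<..<xR i} (ci i) u" "helmholtz_on {xR i<..<xL (i + 1)} co u"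
  by (rule represented_helmholtz[OF left_less_right piecewise_inner], assumption)
     (rule represented_helmholtz[OF right_less_left piecewise_outer], assumption)

lemma piecewise_limits:
  "(vderiv u \<longlongrightarrow> qI i) (at_right (xL i))"
  "(vderiv u \<longlongrightarrow> dsol (ci i) (pI i) (qI i) (xR i - xL i)) (at_left (xR i))"
  "(vderiv u \<longlongrightarrow> qO i) (at_right (xR i))"
  "(vderiv u \<longlongrightarrow> dsol co (pO i) (qO i) (xL (i + 1) - xR i)) (at_left (xL (i + 1)))"
  using represented_limits[OF left_less_right piecewise_inner] represented_limits[OF right_less_left piecewise_outer]
  by blast+

text \<open>Solutions are linear in their Cauchy data and determine them on any interval of positive
  length (\<open>sol_eq_0\<close>), so a relation between functions is one between data.\<close>

lemma piecewise_quasiperiodic_iff: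
  assumes ci: "\<And>i. ci (i + int N) = ci i"
  shows "(\<forall>x. u (x + L) = \<kappa> * u x) \<longleftrightarrow>
    (\<forall>i. pI (i + int N) = \<kappa> * pI i \<and> qI (i + int N) = \<kappa> * qI i \<and> pO (i + int N) = \<kappa> * pO i \<and> qO (i + int N) = \<kappa> * qO i)"
proof -
  have I: "u (x + L) = sol (ci i) (pI (i + int N)) (qI (i + int N)) (x - xL i)" if "x \<in> {xL i..xR i}" for x i
    using piecewise_inner[of "x + L" "i + int N"] that by (simp add: shift_N ci)
  have O: "u (x + L) = sol co (pO (i + int N)) (qO (i + int N)) (x - xR i)" if "x \<in> {xR i..xL (i + 1)}" for x i
    using piecewise_outer[of "x + L" "i + int N"] that shift_N(1)[of "i + 1"] by (simp add: shift_N algebra_simps)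
  show ?thesis
  proof (intro iffI allI)
    fix i assume q: "\<forall>x. u (x + L) = \<kappa> * u x"
    have "sol (ci i) (pI (i + int N) - \<kappa> * pI i) (qI (i + int N) - \<kappa> * qI i) t = 0" if "t \<in> {0..xR i - xL i}" for t
      using q I[of "xL i + t" i] piecewise_inner[of "xL i + t" i] that by (simp add: sol_diff)
    from sol_eq_0[of "xR i - xL i", OF _ this] have 1: "pI (i + int N) = \<kappa> * pI i" "qI (i + int N) = \<kappa> * qI i"
      using left_less_right[of i] by simp_all
    have "sol co (pO (i + int N) - \<kappa> * pO i) (qO (i + int N) - \<kappa> * qO i) t = 0" if "t \<in> {0..xL (i + 1) - xR i}" for t
      using q O[of "xR i + t" i] piecewise_outer[of "xR i + t" i] that by (simp add: sol_diff)
    from sol_eq_0[of "xL (i + 1) - xR i", OF _ this] have "pO (i + int N) = \<kappa> * pO i" "qO (i + int N) = \<kappa> * qO i"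
      using right_less_left[of i] by simp_all
    with 1 show "pI (i + int N) = \<kappa> * pI i \<and> qI (i + int N) = \<kappa> * qI i \<and> pO (i + int N) = \<kappa> * pO i \<and> qO (i + int N) = \<kappa> * qO i"
      by blast
  next
    fix x assume q: "\<forall>i. pI (i + int N) = \<kappa> * pI i \<and> qI (i + int N) = \<kappa> * qI i \<and> pO (i + int N) = \<kappa> * pO i \<and> qO (i + int N) = \<kappa> * qO i"
    show "u (x + L) = \<kappa> * u x"
    proof (cases x rule: piece_cases)
      case (1 i)
      then show ?thesis using q I[of x i] piecewise_inner[of x i] by (simp add: sol_scale)
    next
      case (2 i)
      then show ?thesis using q O[of x i] piecewise_outer[of x i] by (simp add: sol_scale)
    qed
  qed
qed

end

lemma piecewise_unique:
  assumes "piecewise ci co pI qI pO qO u" "piecewise ci co pI qI pO qO w"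
  shows "u = w"
proof
  fix x show "u x = w x"
  proof (cases x rule: piece_cases)
    case (1 i)
    then show ?thesis using piecewise_inner[OF assms(1), of x i] piecewise_inner[OF assms(2), of x i] by simp
  next
    case (2 i)
    then show ?thesis using piecewise_outer[OF assms(1), of x i] piecewise_outer[OF assms(2), of x i] by simp
  qed
qed

lemma piecewise_representation:
  assumes cont: "continuous_on UNIV u" and "\<And>i. helmholtz_on {xL i<..<xR i} (ci i) u"
    and "\<And>i. helmholtz_on {xR i<..<xL (i + 1)} co u"
  shows "\<exists>pI qI pO qO. piecewise ci co pI qI pO qO u"
proof -
  have c: "continuous_on A u" for A using cont continuous_on_subset by blast
  have "\<forall>i. \<exists>d. \<forall>x\<in>{xL i..xR i}. u x = sol (ci i) (fst d) (snd d) (x - xL i)"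
    using helmholtz_representation[OF left_less_right c assms(2)] by simp
  from choice[OF this] obtain dI where dI: "\<forall>i. \<forall>x\<in>{xL i..xR i}. u x = sol (ci i) (fst (dI i)) (snd (dI i)) (x - xL i)" ..
  have "\<forall>i. \<exists>d. \<forall>x\<in>{xR i..xL (i + 1)}. u x = sol co (fst d) (snd d) (x - xR i)"
    using helmholtz_representation[OF right_less_left c assms(3)] by simp
  from choice[OF this] obtain dO where "\<forall>i. \<forall>x\<in>{xR i..xL (i + 1)}. u x = sol co (fst (dO i)) (snd (dO i)) (x - xR i)" ..
  with dI have "piecewise ci co (fst \<circ> dI) (snd \<circ> dI) (fst \<circ> dO) (snd \<circ> dO) u"
    by (simp add: piecewise_def)
  then show ?thesis by blast
qed

definition bloch_ext :: "complex \<Rightarrow> (nat \<Rightarrow> complex) \<Rightarrow> int \<Rightarrow> complex" where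
  "bloch_ext \<kappa> a i = \<kappa> powi per i * a (res i)"

lemma bloch_ext_nat [simp]: "r < N \<Longrightarrow> bloch_ext \<kappa> a (int r + 1) = a r"
  by (simp add: bloch_ext_def)

lemma bloch_ext_shift: "\<kappa> \<noteq> 0 \<Longrightarrow> bloch_ext \<kappa> a (i + int N) = \<kappa> * bloch_ext \<kappa> a i"
  using res_shift[of i 1] per_shift[of i 1] by (simp add: bloch_ext_def power_int_add)

text \<open>The index N lies past the last residue. Prescribing \<open>a N = \<kappa> * a 0\<close>
  absorbs the change of period, so recursions for a extend to all integers without a separate
  wrap-around case.\<close>

lemma bloch_ext_Suc:
  assumes "\<kappa> \<noteq> 0" "a N = \<kappa> * a 0"
  shows "bloch_ext \<kappa> a (i + 1) = \<kappa> powi per i * a (Suc (res i))"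
  by (cases i rule: index_cases) (use assms in \<open>simp_all add: bloch_ext_def power_int_add\<close>)

end

section \<open>Resonances and the monodromy matrix\<close>

lemma helmholtz_on_UN: "helmholtz_on (\<Union>i\<in>I. S i) c u \<longleftrightarrow> (\<forall>i\<in>I. helmholtz_on (S i) c u)"
  by (auto simp: helmholtz_on_def)

text \<open>Uniqueness of limits turns the existential form of the transmission conditions into
  equations between Cauchy data.\<close>

lemma ex_limits_iff:
  fixes f g :: "real \<Rightarrow> complex"
  assumes "(f \<longlongrightarrow> a) F" "(g \<longlongrightarrow> b) G" "F \<noteq> bot" "G \<noteq> bot"
  shows "(\<exists>p q. (f \<longlongrightarrow> p) F \<and> (g \<longlongrightarrow> q) G \<and> P p q) \<longleftrightarrow> P a b"
proof
  assume "\<exists>p q. (f \<longlongrightarrow> p) F \<and> (g \<longlongrightarrow> q) G \<and> P p q"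
  then obtain p q where pq: "(f \<longlongrightarrow> p) F" "(g \<longlongrightarrow> q) G" "P p q" by blast
  have "p = a" "q = b"
    using tendsto_unique[OF assms(3) pq(1) assms(1)] tendsto_unique[OF assms(4) pq(2) assms(2)] by auto
  then show "P a b" using pq(3) by simp
qed (use assms in blast)

context chain
begin

definition len :: "nat \<Rightarrow> real" where "len r = xR (int r + 1) - xL (int r + 1)"
definition gap :: "nat \<Rightarrow> real" where "gap r = xL (int r + 1 + 1) - xR (int r + 1)"

lemma len_pos: "len r > 0" and gap_pos: "gap r > 0"
  using left_less_right[of "int r + 1"] right_less_left[of "int r + 1"] by (simp_all add: len_def gap_def)

lemma len_res: "xR i - xL i = len (res i)"
  by (subst (1 2) index_split) (simp add: shift len_def)

lemma gap_res: "xL (i + 1) - xR i = gap (res i)"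
proof -
  have "i + 1 = (int (res i) + 1 + 1) + per i * int N" using index_split[of i] by simp
  then have "xL (i + 1) = xL (int (res i) + 1 + 1) + of_int (per i) * L" using shift(1) by metis
  moreover have "xR i = xR (int (res i) + 1) + of_int (per i) * L" using index_split[of i] shift(2) by metis
  ultimately show ?thesis by (simp add: gap_def)
qed

lemma transmission_iff:
  assumes "piecewise ci co pI qI pO qO u"
  shows "transmission xL xR \<delta> u \<longleftrightarrow>
    (\<forall>i. qI (i + 1) = of_real \<delta> * dsol co (pO i) (qO i) (gap (res i)) \<and>
         of_real \<delta> * qO i = dsol (ci i) (pI i) (qI i) (len (res i)))"
proof -
  have L: "(\<exists>p q. (vderiv u \<longlongrightarrow> p) (at_right (xL (i + 1))) \<and> (vderiv u \<longlongrightarrow> q) (at_left (xL (i + 1))) \<and> p = of_real \<delta> * q)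
      \<longleftrightarrow> qI (i + 1) = of_real \<delta> * dsol co (pO i) (qO i) (gap (res i))" for i
    using ex_limits_iff[OF piecewise_limits(1)[OF assms, of "i + 1"] piecewise_limits(4)[OF assms, of i],
        of "\<lambda>p q. p = of_real \<delta> * q"] by (simp add: gap_res)
  have R: "(\<exists>p q. (vderiv u \<longlongrightarrow> p) (at_right (xR i)) \<and> (vderiv u \<longlongrightarrow> q) (at_left (xR i)) \<and> of_real \<delta> * p = q)
      \<longleftrightarrow> of_real \<delta> * qO i = dsol (ci i) (pI i) (qI i) (len (res i))" for i
    using ex_limits_iff[OF piecewise_limits(3)[OF assms, of i] piecewise_limits(2)[OF assms, of i],
        of "\<lambda>p q. of_real \<delta> * p = q"] by (simp add: len_res)
  \<comment> \<open>The condition at a left end point is shifted to i + 1, so that both conditions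
    are expressed by the data of resonator i and the gap after it.\<close>
  have reindex: "(\<forall>i::int. P i) \<longleftrightarrow> (\<forall>i. P (i + 1))" for P
    by (metis diff_add_cancel)
  show ?thesis
    unfolding transmission_def all_conj_distrib R
    by (subst reindex) (simp only: L)
qed

lemma bloch_mode_iff:
  "bloch_mode N L xL xR v vr \<alpha> \<delta> w u \<longleftrightarrow>
     continuous_on UNIV u \<and> (\<exists>x. u x \<noteq> 0) \<and>
     (\<forall>i. helmholtz_on {xR i<..<xL (i + 1)} (w\<^sup>2 / (of_real v)\<^sup>2) u) \<and>
     (\<forall>i. helmholtz_on {xL i<..<xR i} (w\<^sup>2 / (vr (Suc (res i)))\<^sup>2) u) \<and>
     transmission xL xR \<delta> u \<and> (\<forall>x. u (x + L) = cis (\<alpha> * L) * u x)"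
proof -
  have "(\<forall>i\<in>{1..N}. helmholtz_on (resonator_translates L xL xR (int i)) (w\<^sup>2 / (vr i)\<^sup>2) u) \<longleftrightarrow>
    (\<forall>i. helmholtz_on {xL i<..<xR i} (w\<^sup>2 / (vr (Suc (res i)))\<^sup>2) u)"
  proof (intro iffI allI ballI)
    fix i assume *: "\<forall>i\<in>{1..N}. helmholtz_on (resonator_translates L xL xR (int i)) (w\<^sup>2 / (vr i)\<^sup>2) u"
    have "Suc (res i) \<in> {1..N}" using res_less[of i] by simp
    with * have "helmholtz_on (resonator_translates L xL xR (int (Suc (res i)))) (w\<^sup>2 / (vr (Suc (res i)))\<^sup>2) u" by blast
    then have "helmholtz_on {xL (int (Suc (res i)) + per i * int N)<..<xR (int (Suc (res i)) + per i * int N)} (w\<^sup>2 / (vr (Suc (res i)))\<^sup>2) u"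
      unfolding translates_eq helmholtz_on_UN by blast
    moreover have "int (Suc (res i)) + per i * int N = i" using index_split[of i] by simp
    ultimately show "helmholtz_on {xL i<..<xR i} (w\<^sup>2 / (vr (Suc (res i)))\<^sup>2) u" by simp
  next
    fix i assume *: "\<forall>i. helmholtz_on {xL i<..<xR i} (w\<^sup>2 / (vr (Suc (res i)))\<^sup>2) u" and i: "i \<in> {1..N}"
    then obtain r where r: "i = Suc r" "r < N" by (cases i) auto
    have "Suc (res (int i + m * int N)) = i" for m
      using res_per_eq(1)[OF r(2), of m] r(1) by (simp add: add.commute)
    then have "helmholtz_on {xL (int i + m * int N)<..<xR (int i + m * int N)} (w\<^sup>2 / (vr i)\<^sup>2) u" for m
      using spec[OF *, of "int i + m * int N"] by simp
    then show "helmholtz_on (resonator_translates L xL xR (int i)) (w\<^sup>2 / (vr i)\<^sup>2) u"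
      unfolding translates_eq helmholtz_on_UN by blast
  qed
  then show ?thesis unfolding bloch_mode_def outside_eq helmholtz_on_UN by auto
qed

text \<open>A mode determines its states at the left end points, and a sequence of states multiplied
  by \<kappa> over a period can be filled in to a mode. As \<delta> is nonzero, inner and outer
  derivatives determine each other.\<close>

lemma scattering_resonance_iff:
  fixes v \<alpha> \<delta> :: real and w :: complex and vr :: "nat \<Rightarrow> complex"
  assumes "\<delta> > 0"
  defines "\<kappa> \<equiv> cis (\<alpha> * L)"
  shows "scattering_resonance N L xL xR v vr \<alpha> \<delta> w \<longleftrightarrow>
    tr2 (monodromy (1 / (of_real v)\<^sup>2) (\<lambda>r. 1 / (vr (Suc r))\<^sup>2) len gap N 1 (w\<^sup>2 / of_real \<delta>) (w\<^sup>2) \<delta>) = \<kappa> + 1 / \<kappa>"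
proof -
  define k0 where "k0 = 1 / (complex_of_real v)\<^sup>2"
  define k where "k r = 1 / (vr (Suc r))\<^sup>2" for r
  define M where "M r = cell k0 (k r) 1 (w\<^sup>2 / of_real \<delta>) (w\<^sup>2) \<delta> (len r) (gap r)" for r
  define ci where "ci i = k (res i) * w\<^sup>2" for i
  define co where "co = k0 * w\<^sup>2"
  have \<kappa>: "\<kappa> \<noteq> 0" by (simp add: \<kappa>_def)
  have \<delta>: "\<delta> \<noteq> 0" using assms by simp
  have ci_shift: "ci (i + int N) = ci i" for i using res_shift[of i 1] by (simp add: ci_def)
  have ce: "w\<^sup>2 / (of_real v)\<^sup>2 = co" "w\<^sup>2 / (vr (Suc (res i)))\<^sup>2 = ci i" for i
    by (simp_all add: co_def ci_def k0_def k_def)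
  note mode = bloch_mode_iff[of v vr \<alpha> \<delta> w, unfolded ce, folded \<kappa>_def]
  have mono: "monodromy k0 k len gap N 1 (w\<^sup>2 / of_real \<delta>) (w\<^sup>2) \<delta> = prod2 M N"
    by (simp add: monodromy_def M_def[abs_def])
  have "det2 (prod2 M N) = 1"
    using det_monodromy[of k0 k len gap N "w\<^sup>2 / of_real \<delta>" \<delta>] \<delta> by (simp add: mono)
  note eig = unimodular_eigenvalue_iff[OF this \<kappa>]
  have "(\<exists>u. bloch_mode N L xL xR v vr \<alpha> \<delta> w u) \<longleftrightarrow>
    (\<exists>p q. (p, q) \<noteq> (0, 0) \<and> e11 (prod2 M N) * p + e12 (prod2 M N) * q = \<kappa> * p \<and>
       e21 (prod2 M N) * p + e22 (prod2 M N) * q = \<kappa> * q)"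
  proof
    assume "\<exists>u. bloch_mode N L xL xR v vr \<alpha> \<delta> w u"
    then obtain u where u: "continuous_on UNIV u" "\<exists>x. u x \<noteq> 0"
      "\<And>i. helmholtz_on {xR i<..<xL (i + 1)} co u" "\<And>i. helmholtz_on {xL i<..<xR i} (ci i) u"
      "transmission xL xR \<delta> u" "\<forall>x. u (x + L) = \<kappa> * u x"
      unfolding mode by blast
    obtain pI qI pO qO where pw: "piecewise ci co pI qI pO qO u"
      using piecewise_representation[OF u(1,4,3)] by blast
    have qp: "pI (i + int N) = \<kappa> * pI i" "pO (i + int N) = \<kappa> * pO i" "qO (i + int N) = \<kappa> * qO i" for i
      using u(6) unfolding piecewise_quasiperiodic_iff[OF pw ci_shift] by blast+
    \<comment> \<open>The outer derivative just to the left of \<open>xL i\<close>, computed from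
      the preceding gap.\<close>
    define g where "g i = dsol co (pO (i - 1)) (qO (i - 1)) (gap (res (i - 1)))" for i
    have tr: "qI i = of_real \<delta> * g i" "of_real \<delta> * qO i = dsol (ci i) (pI i) (qI i) (len (res i))" for i
    proof -
      have "qI (i - 1 + 1) = of_real \<delta> * dsol co (pO (i - 1)) (qO (i - 1)) (gap (res (i - 1)))"
        using u(5) unfolding transmission_iff[OF pw] by blast
      then show "qI i = of_real \<delta> * g i" by (simp add: g_def)
      show "of_real \<delta> * qO i = dsol (ci i) (pI i) (qI i) (len (res i))"
        using u(5) unfolding transmission_iff[OF pw] by blast
    qed
    have pO: "pO i = sol (k (res i) * w\<^sup>2) (pI i) (of_real \<delta> * g i) (len (res i))" for i
      using piecewise_endpoints(3)[OF pw, of i] by (simp add: len_res tr(1) ci_def)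
    have qO: "qO i = dsol (k (res i) * w\<^sup>2) (pI i) (of_real \<delta> * g i) (len (res i)) / of_real \<delta>" for i
      using tr(2)[of i] \<delta> by (simp add: tr(1) ci_def field_simps)
    have advance: "pI (i + 1) = e11 (M (res i)) * pI i + e12 (M (res i)) * g i"
        "g (i + 1) = e21 (M (res i)) * pI i + e22 (M (res i)) * g i" for i
    proof -
      show "pI (i + 1) = e11 (M (res i)) * pI i + e12 (M (res i)) * g i"
        using piecewise_endpoints(4)[OF pw, of i] cell_step(1)[OF \<delta>] unfolding gap_res pO qO co_def M_def by simp
      show "g (i + 1) = e21 (M (res i)) * pI i + e22 (M (res i)) * g i"
        using cell_step(2)[OF \<delta>] unfolding g_def[of "i + 1"] pO qO co_def M_def by simp
    qed
    have gN: "g (i + int N) = \<kappa> * g i" for i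
    proof -
      have e: "i + int N - 1 = (i - 1) + int N" by simp
      show ?thesis using qp(2,3)[of "i - 1"] res_shift[of "i - 1" 1] unfolding g_def e by (simp add: sol_scale)
    qed
    have it: "pI (int N + 1) = e11 (prod2 M N) * pI (int 0 + 1) + e12 (prod2 M N) * g (int 0 + 1) \<and>
        g (int N + 1) = e21 (prod2 M N) * pI (int 0 + 1) + e22 (prod2 M N) * g (int 0 + 1)"
    proof (rule prod2_iterate[of N "\<lambda>n. pI (int n + 1)" M "\<lambda>n. g (int n + 1)"])
      fix n assume "n < N"
      then have r: "res (int n + 1) = n" by simp
      have e: "int (Suc n) + 1 = (int n + 1) + 1" by simp
      show "pI (int (Suc n) + 1) = e11 (M n) * pI (int n + 1) + e12 (M n) * g (int n + 1)"
        "g (int (Suc n) + 1) = e21 (M n) * pI (int n + 1) + e22 (M n) * g (int n + 1)"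
        unfolding e advance[of "int n + 1"] r by (rule refl)+
    qed
    \<comment> \<open>Zero initial state propagates only forward and kills u on the half line x
      \<ge> 0. Any other point is moved there by whole periods, at the cost of a nonzero power of
      \<kappa>.\<close>
    have "(pI 1, g 1) \<noteq> (0, 0)"
    proof
      assume "(pI 1, g 1) = (0, 0)"
      have z: "pI i = 0 \<and> g i = 0" if "i \<ge> 1" for i
        using that
      proof (induction i rule: int_ge_induct)
        case base
        then show ?case using \<open>(pI 1, g 1) = (0, 0)\<close> by simp
      next
        case (step i)
        then show ?case using advance[of i] by simp
      qed
      have zero: "u x = 0" if "x \<ge> 0" for x
      proof (cases x rule: piece_cases)
        case (1 i)
        then have "i \<ge> 1" using that left_less_right[of i] left_mono_le[of "i + 1" 1] right_less_left[of i] by (force simp: xL_1)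
        then show ?thesis using z[of i] piecewise_inner[OF pw, of x i] 1 tr(1)[of i] by (simp add: sol_def)
      next
        case (2 i)
        then have "i \<ge> 1" using that left_mono_le[of "i + 1" 1] by (force simp: xL_1)
        then have "pO i = 0" "qO i = 0" using z[of i] pO[of i] qO[of i] by (simp_all add: sol_def dsol_def)
        then show ?thesis using piecewise_outer[OF pw, of x i] 2 by (simp add: sol_def)
      qed
      have iter: "u (x + real n * L) = \<kappa> ^ n * u x" for x n
      proof (induction n)
        case (Suc n)
        have "x + real (Suc n) * L = (x + real n * L) + L" by (simp add: algebra_simps)
        then have "u (x + real (Suc n) * L) = \<kappa> * u (x + real n * L)" using u(6) by metis
        then show ?case using Suc by simp
      qed simp
      have "u x = 0" for x
      proof -
        obtain n where "real n * L > - x" using reals_Archimedean3[OF L_pos] by blast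
        then have "\<kappa> ^ n * u x = 0" using zero[of "x + real n * L"] iter[of x n] by simp
        then show ?thesis using \<kappa> by simp
      qed
      then show False using u(2) by blast
    qed
    moreover have "pI (int N + 1) = \<kappa> * pI 1" "g (int N + 1) = \<kappa> * g 1"
      using qp(1)[of 1] gN[of 1] by (simp_all add: add.commute)
    ultimately show "\<exists>p q. (p, q) \<noteq> (0, 0) \<and> e11 (prod2 M N) * p + e12 (prod2 M N) * q = \<kappa> * p \<and>
       e21 (prod2 M N) * p + e22 (prod2 M N) * q = \<kappa> * q"
      using it by (intro exI[of _ "pI 1"] exI[of _ "g 1"]) simp
  next
    assume "\<exists>p q. (p, q) \<noteq> (0, 0) \<and> e11 (prod2 M N) * p + e12 (prod2 M N) * q = \<kappa> * p \<and>
       e21 (prod2 M N) * p + e22 (prod2 M N) * q = \<kappa> * q"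
    then obtain p q where pq: "(p, q) \<noteq> (0, 0)" "e11 (prod2 M N) * p + e12 (prod2 M N) * q = \<kappa> * p"
       "e21 (prod2 M N) * p + e22 (prod2 M N) * q = \<kappa> * q" by blast
    define P where "P n = e11 (prod2 M n) * p + e12 (prod2 M n) * q" for n
    define G where "G n = e21 (prod2 M n) * p + e22 (prod2 M n) * q" for n
    have P0: "P 0 = p" "G 0 = q" by (simp_all add: P_def G_def)
    have PN: "P N = \<kappa> * P 0" "G N = \<kappa> * G 0" unfolding P0 by (simp_all add: P_def G_def pq)
    have PS: "P (Suc n) = e11 (M n) * P n + e12 (M n) * G n" "G (Suc n) = e21 (M n) * P n + e22 (M n) * G n" for n
      by (simp_all add: P_def G_def mul2_def algebra_simps)
    \<comment> \<open>The states of one period, started from the eigenvector, are continued to all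
      integers; the eigenvalue equation is exactly the wrap-around condition
      \<open>PN\<close>.\<close>
    define pI where "pI = bloch_ext \<kappa> P"
    define g where "g = bloch_ext \<kappa> G"
    have step: "pI (i + 1) = e11 (M (res i)) * pI i + e12 (M (res i)) * g i"
        "g (i + 1) = e21 (M (res i)) * pI i + e22 (M (res i)) * g i" for i
      unfolding pI_def g_def bloch_ext_Suc[OF \<kappa> PN(1)] bloch_ext_Suc[OF \<kappa> PN(2)] PS
      by (simp_all add: bloch_ext_def algebra_simps)
    define qI where "qI i = of_real \<delta> * g i" for i
    define pO where "pO i = sol (k (res i) * w\<^sup>2) (pI i) (of_real \<delta> * g i) (len (res i))" for i
    define qO where "qO i = dsol (k (res i) * w\<^sup>2) (pI i) (of_real \<delta> * g i) (len (res i)) / of_real \<delta>" for i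
    have next_state: "sol co (pO i) (qO i) (gap (res i)) = pI (i + 1)" "dsol co (pO i) (qO i) (gap (res i)) = g (i + 1)" for i
      unfolding step co_def pO_def qO_def M_def by (rule cell_step[OF \<delta>])+
    obtain u where pw: "piecewise ci co pI qI pO qO u"
      using piecewise_exists[of ci pI qI pO co qO]
      by (auto simp: len_res gap_res next_state) (auto simp: pO_def qI_def ci_def)
    have sh: "pI (i + int N) = \<kappa> * pI i" "g (i + int N) = \<kappa> * g i" for i
      by (simp_all add: pI_def g_def bloch_ext_shift[OF \<kappa>])
    have sh_qI: "qI (i + int N) = of_real \<delta> * g (i + int N)" for i by (simp add: qI_def)
    have scale: "of_real \<delta> * (\<kappa> * x) = \<kappa> * (of_real \<delta> * x)" for x by simp
    have "pO (i + int N) = \<kappa> * pO i" "qO (i + int N) = \<kappa> * qO i" "qI (i + int N) = \<kappa> * qI i" for i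
      using res_shift[of i 1] unfolding pO_def qO_def sh sh_qI scale by (simp_all add: sol_scale qI_def)
    then have per: "\<forall>x. u (x + L) = \<kappa> * u x"
      unfolding piecewise_quasiperiodic_iff[OF pw ci_shift] using sh by blast
    have "transmission xL xR \<delta> u"
      unfolding transmission_iff[OF pw] next_state using \<delta> by (simp add: qI_def qO_def ci_def)
    moreover have "\<exists>x. u x \<noteq> 0"
    proof (rule ccontr)
      assume "\<not> (\<exists>x. u x \<noteq> 0)"
      then have z: "u x = 0" for x by blast
      have "sol (ci 1) (pI 1) (qI 1) t = 0" if "t \<in> {0..xR 1 - xL 1}" for t
        using piecewise_inner[OF pw, of "xL 1 + t" 1] that z by simp
      from sol_eq_0[of "xR 1 - xL 1", OF _ this] have "pI 1 = 0" "qI 1 = 0" using left_less_right[of 1] by simp_all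
      moreover have "pI 1 = p" "g 1 = q"
        using bloch_ext_nat[OF N_pos, of \<kappa>] P0 by (simp_all add: pI_def g_def)
      ultimately show False using pq(1) \<delta> by (simp add: qI_def)
    qed
    ultimately have "bloch_mode N L xL xR v vr \<alpha> \<delta> w u"
      unfolding mode using per piecewise_continuous[OF pw] piecewise_helmholtz[OF pw] by blast
    then show "\<exists>u. bloch_mode N L xL xR v vr \<alpha> \<delta> w u" by blast
  qed
  then have "scattering_resonance N L xL xR v vr \<alpha> \<delta> w \<longleftrightarrow> tr2 (prod2 M N) = \<kappa> + 1 / \<kappa>"
    unfolding scattering_resonance_def eig .
  moreover have "prod2 M N =
      monodromy (1 / (of_real v)\<^sup>2) (\<lambda>r. 1 / (vr (Suc r))\<^sup>2) len gap N 1 (w\<^sup>2 / of_real \<delta>) (w\<^sup>2) \<delta>"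
    by (simp add: monodromy_def M_def[abs_def] k_def k0_def)
  ultimately show ?thesis by simp
qed

end

section \<open>The capacitance matrix\<close>

context chain
begin

lemma quasiperiodic_iterate:
  fixes u :: "real \<Rightarrow> complex"
  assumes "\<And>x. u (x + L) = \<kappa> * u x" "\<kappa> \<noteq> 0"
  shows "u (x + of_int m * L) = \<kappa> powi m * u x"
proof (induction m rule: int_induct[where k = 0])
  case (step1 m)
  have "x + of_int (m + 1) * L = (x + of_int m * L) + L" by (simp add: algebra_simps)
  then have "u (x + of_int (m + 1) * L) = \<kappa> * u (x + of_int m * L)" using assms(1) by metis
  then show ?case using step1 assms(2) by (simp add: power_int_add)
next
  case (step2 m)
  have "x + of_int m * L = (x + of_int (m - 1) * L) + L" by (simp add: algebra_simps)
  then have "u (x + of_int m * L) = \<kappa> * u (x + of_int (m - 1) * L)" using assms(1) by metis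
  then show ?case using step2 assms(2) by (simp add: power_int_diff field_simps)
qed simp

text \<open>The constant value on resonator i of the potential belonging to matrix index j,
  including the phase of the period.\<close>

definition unit_ext :: "complex \<Rightarrow> nat \<Rightarrow> int \<Rightarrow> complex" where
  "unit_ext \<kappa> j = bloch_ext \<kappa> (\<lambda>r. if r = j then 1 else 0)"

text \<open>The derivative in the gap to the right of resonator i of the affine interpolation of the
  values A.\<close>

definition slope :: "(int \<Rightarrow> complex) \<Rightarrow> int \<Rightarrow> complex" where
  "slope A i = (A (i + 1) - A i) / of_real (gap (res i))"

text \<open>A potential is constant on resonators and affine in gaps, a piecewise solution with c =
  0 and prescribed data. Existence and uniqueness, which make the definite description in
  \<open>cap_potential\<close> meaningful, follow from this form.\<close>

lemma cap_potential_piecewise_iff: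
  fixes \<alpha> :: real
  defines "\<kappa> \<equiv> cis (\<alpha> * L)"
  shows "is_cap_potential N L xL xR \<alpha> (Suc j) V \<longleftrightarrow>
    piecewise (\<lambda>_. 0) 0 (unit_ext \<kappa> j) (\<lambda>_. 0) (unit_ext \<kappa> j) (slope (unit_ext \<kappa> j)) V"
    (is "_ \<longleftrightarrow> piecewise _ _ ?d _ _ _ V")
proof
  have \<kappa>: "\<kappa> \<noteq> 0" by (simp add: \<kappa>_def)
  have cis_m: "cis (\<alpha> * of_int m * L) = \<kappa> powi m" for m
    by (simp add: \<kappa>_def cis_power_int mult_ac)
  note cap_def = is_cap_potential_def outside_eq helmholtz_on_UN cis_m
  {
    assume "is_cap_potential N L xL xR \<alpha> (Suc j) V"
    then have V: "continuous_on UNIV V" "\<And>i. helmholtz_on {xR i<..<xL (i + 1)} 0 V"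
      "\<And>i x. i \<in> {1..N} \<Longrightarrow> x \<in> {xL (int i)<..<xR (int i)} \<Longrightarrow> V x = (if i = Suc j then 1 else 0)"
      "\<And>x m. V (x + of_int m * L) = \<kappa> powi m * V x"
      unfolding cap_def by blast+
    have cont: "continuous_on A V" for A using V(1) continuous_on_subset by blast
    have inside: "V x = ?d i" if x: "x \<in> {xL i<..<xR i}" for x i
    proof -
      have "x - of_int (per i) * L \<in> {xL (int (Suc (res i)))<..<xR (int (Suc (res i)))}"
      proof -
        have "i = int (Suc (res i)) + per i * int N" using index_split[of i] by simp
        then have "xL i = xL (int (Suc (res i))) + of_int (per i) * L" "xR i = xR (int (Suc (res i))) + of_int (per i) * L"
          using shift by metis+
        then show ?thesis using x by simp
      qed
      then have "V (x - of_int (per i) * L) = (if res i = j then 1 else 0)"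
        using V(3)[of "Suc (res i)"] res_less[of i] by simp
      then show ?thesis using V(4)[of "x - of_int (per i) * L" "per i"]
        by (simp add: unit_ext_def bloch_ext_def)
    qed
    have inner: "V x = ?d i" if "x \<in> {xL i..xR i}" for x i
      using continuous_constant_on_closure[of "{xL i<..<xR i}" V "?d i" x] cont inside that left_less_right[of i]
      by simp
    have outer: "V x = sol 0 (?d i) (slope ?d i) (x - xR i)" if x: "x \<in> {xR i..xL (i + 1)}" for x i
    proof -
      obtain p q where pq: "\<And>x. x \<in> {xR i..xL (i + 1)} \<Longrightarrow> V x = sol 0 p q (x - xR i)"
        using helmholtz_representation[OF right_less_left cont V(2)] by blast
      have p: "p = ?d i"
        using pq[of "xR i"] inner[of "xR i" i] right_less_left[of i] left_less_right[of i] by simp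
      have "p + q * of_real (gap (res i)) = ?d (i + 1)"
        using pq[of "xL (i + 1)"] inner[of "xL (i + 1)" "i + 1"] right_less_left[of i] left_less_right[of "i + 1"]
        by (simp add: sol_def gap_res)
      then have "q = slope ?d i" using p gap_pos[of "res i"] by (simp add: slope_def field_simps)
      then show ?thesis using pq x p by simp
    qed
    show "piecewise (\<lambda>_. 0) 0 ?d (\<lambda>_. 0) ?d (slope ?d) V"
      unfolding piecewise_def using inner outer by (simp add: sol_def)
  }
  assume pw: "piecewise (\<lambda>_. 0) 0 ?d (\<lambda>_. 0) ?d (slope ?d) V"
  have d: "?d (i + int N) = \<kappa> * ?d i" for i unfolding unit_ext_def by (rule bloch_ext_shift[OF \<kappa>])
  have "slope ?d (i + int N) = \<kappa> * slope ?d i" for i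
    using d[of i] d[of "i + 1"] res_shift[of i 1] by (simp add: slope_def algebra_simps diff_divide_distrib)
  then have "V (x + L) = \<kappa> * V x" for x
    using d piecewise_quasiperiodic_iff[OF pw, of \<kappa>] by simp
  then have "V (x + of_int m * L) = \<kappa> powi m * V x" for x m
    using quasiperiodic_iterate \<kappa> by blast
  moreover have "V x = (if i = Suc j then 1 else 0)" if i: "i \<in> {1..N}" and x: "x \<in> {xL (int i)<..<xR (int i)}" for i x
  proof -
    obtain r where r: "i = Suc r" "r < N" using i by (cases i) auto
    then have "?d (int i) = (if r = j then 1 else 0)"
      using bloch_ext_nat[of r] by (simp add: unit_ext_def add.commute)
    then show ?thesis using piecewise_inner[OF pw, of x "int i"] x r by (simp add: sol_def)
  qed
  ultimately show "is_cap_potential N L xL xR \<alpha> (Suc j) V"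
    unfolding cap_def using piecewise_continuous[OF pw] piecewise_helmholtz(2)[OF pw] by blast
qed

lemma cap_potential_piecewise:
  fixes \<alpha> :: real
  defines "\<kappa> \<equiv> cis (\<alpha> * L)"
  shows "piecewise (\<lambda>_. 0) 0 (unit_ext \<kappa> j) (\<lambda>_. 0) (unit_ext \<kappa> j) (slope (unit_ext \<kappa> j)) (cap_potential N L xL xR \<alpha> (Suc j))"
proof -
  let ?d = "unit_ext \<kappa> j"
  have g: "of_real (gap r) \<noteq> (0::complex)" for r using gap_pos[of r] by simp
  obtain V where V: "piecewise (\<lambda>_. 0) 0 ?d (\<lambda>_. 0) ?d (slope ?d) V"
    using piecewise_exists[of "\<lambda>_. 0" ?d "\<lambda>_. 0" ?d 0 "slope ?d"] g
    by (auto simp: gap_res sol_def slope_def)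
  have "cap_potential N L xL xR \<alpha> (Suc j) = V"
    unfolding cap_potential_def cap_potential_piecewise_iff \<kappa>_def[symmetric]
    by (rule the_equality) (fact V, rule piecewise_unique[OF _ V])
  then show ?thesis using V by simp
qed

text \<open>Row i belongs to resonator i + 1, which lies between the gaps i and i + 1; for i = 0 the
  left gap belongs to the previous period.\<close>

lemma cap_matrix_index:
  fixes \<alpha> :: real
  defines "\<kappa> \<equiv> cis (\<alpha> * L)"
  assumes "i < N" "j < N"
  shows "cap_matrix N L xL xR \<alpha> $$ (i, j) = slope (unit_ext \<kappa> j) (int i) - slope (unit_ext \<kappa> j) (int i + 1)"
proof -
  note pw = cap_potential_piecewise[of \<alpha> j, folded \<kappa>_def]
  have e: "int (Suc i) = int i + 1" by simp
  have "Lim (at_left (xL (int i + 1))) (vderiv (cap_potential N L xL xR \<alpha> (Suc j))) = slope (unit_ext \<kappa> j) (int i)"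
    using piecewise_limits(4)[OF pw, of "int i"] by (intro tendsto_Lim) (simp_all add: dsol_def)
  moreover have "Lim (at_right (xR (int i + 1))) (vderiv (cap_potential N L xL xR \<alpha> (Suc j))) = slope (unit_ext \<kappa> j) (int i + 1)"
    using piecewise_limits(3)[OF pw, of "int i + 1"] by (intro tendsto_Lim) simp_all
  ultimately show ?thesis using assms(2,3) unfolding cap_matrix_def e by (simp add: add.commute)
qed

lemma bloch_ext_sum: "bloch_ext \<kappa> a i = (\<Sum>j<N. unit_ext \<kappa> j i * a j)"
proof -
  have "(\<Sum>j<N. unit_ext \<kappa> j i * a j) = (\<Sum>j<N. if j = res i then \<kappa> powi per i * a j else 0)"
    by (intro sum.cong) (auto simp: unit_ext_def bloch_ext_def)
  also have "\<dots> = bloch_ext \<kappa> a i" using res_less[of i] by (simp add: bloch_ext_def)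
  finally show ?thesis by simp
qed

lemma slope_sum: "slope (bloch_ext \<kappa> a) i = (\<Sum>j<N. slope (unit_ext \<kappa> j) i * a j)"
  unfolding slope_def bloch_ext_sum[of \<kappa> a]
  by (simp add: sum_divide_distrib sum_subtractf[symmetric] algebra_simps diff_divide_distrib)

lemma gen_cap_matrix_eq:
  "gen_cap_matrix N L xL xR vr \<alpha> =
     Matrix.mat N N (\<lambda>(i, j). (vr (Suc i))\<^sup>2 / of_real (len i) * cap_matrix N L xL xR \<alpha> $$ (i, j))"
proof -
  have C: "cap_matrix N L xL xR \<alpha> \<in> carrier_mat N N" by (simp add: cap_matrix_def)
  have sq: "(mat_diag N f) ^\<^sub>m 2 = mat_diag N (\<lambda>i. f i * f i)" for f :: "nat \<Rightarrow> complex"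
  proof -
    have "(mat_diag N f) ^\<^sub>m 2 = 1\<^sub>m N * mat_diag N f * mat_diag N f"
      by (simp add: numeral_2_eq_2 mat_diag_def)
    then show ?thesis by (simp add: left_mult_one_mat[OF mat_diag_dim])
  qed
  show ?thesis
    unfolding gen_cap_matrix_def sq mat_diag_diag mat_diag_mult_left[OF C]
    by (rule arg_cong[of _ _ "Matrix.mat N N"])
       (auto simp: fun_eq_iff len_def power2_eq_square divide_inverse add.commute)
qed

text \<open>An eigenvector, continued quasiperiodically, is a discrete Bloch mode, i.e. an eigenvector of the
  transfer matrix at \<open>\<delta> = 0\<close>.\<close>

lemma cap_eigenvalue_trace:
  fixes \<alpha> :: real and a :: "complex Matrix.vec"
  defines "\<kappa> \<equiv> cis (\<alpha> * L)"
  assumes eig: "eigenvector (gen_cap_matrix N L xL xR vr \<alpha>) a \<mu>" and vr: "\<And>i. i \<in> {1..N} \<Longrightarrow> vr i \<noteq> 0"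
  shows "tr2 (monodromy k0 (\<lambda>r. 1 / (vr (Suc r))\<^sup>2) len gap N 1 \<mu> 0 0) = \<kappa> + 1 / \<kappa>"
proof -
  have \<kappa>: "\<kappa> \<noteq> 0" by (simp add: \<kappa>_def)
  define A where "A = bloch_ext \<kappa> (vec_index a)"
  define M where "M r = cell k0 (1 / (vr (Suc r))\<^sup>2) 1 \<mu> 0 0 (len r) (gap r)" for r
  have a: "a \<in> carrier_vec N" "a \<noteq> 0\<^sub>v N" "gen_cap_matrix N L xL xR vr \<alpha> *\<^sub>v a = \<mu> \<cdot>\<^sub>v a"
    using eig by (simp_all add: eigenvector_def gen_cap_matrix_eq)
  \<comment> \<open>Row r of the eigenvalue equation, read as a jump of the slope across a
    resonator: the limit form of the inner equation integrated over length
    \<open>len r\<close>.\<close>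
  have jump: "slope A (int r + 1) = slope A (int r) - \<mu> / (vr (Suc r))\<^sup>2 * of_real (len r) * A (int r + 1)"
    if r: "r < N" for r
  proof -
    have "vec_index (gen_cap_matrix N L xL xR vr \<alpha> *\<^sub>v a) r =
        (\<Sum>j<N. (vr (Suc r))\<^sup>2 / of_real (len r) * cap_matrix N L xL xR \<alpha> $$ (r, j) * vec_index a j)"
      using r a(1) by (simp add: gen_cap_matrix_eq scalar_prod_def atLeast0LessThan)
    also have "\<dots> = (vr (Suc r))\<^sup>2 / of_real (len r) *
        (\<Sum>j<N. (slope (unit_ext \<kappa> j) (int r) - slope (unit_ext \<kappa> j) (int r + 1)) * vec_index a j)"
      unfolding sum_distrib_left
      by (intro sum.cong refl) (simp add: cap_matrix_index[OF r, of _ \<alpha>, folded \<kappa>_def] mult.assoc)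
    also have "\<dots> = (vr (Suc r))\<^sup>2 / of_real (len r) * (slope A (int r) - slope A (int r + 1))"
      unfolding A_def slope_sum by (simp add: sum_subtractf left_diff_distrib)
    finally have "(vr (Suc r))\<^sup>2 / of_real (len r) * (slope A (int r) - slope A (int r + 1)) = \<mu> * A (int r + 1)"
      using a r by (simp add: A_def)
    moreover have "vr (Suc r) \<noteq> 0" using vr[of "Suc r"] r by simp
    moreover have "complex_of_real (len r) \<noteq> 0" using len_pos[of r] by simp
    ultimately show ?thesis by (simp add: field_simps)
  qed
  have advance: "A (int r + 1 + 1) = A (int r + 1) + of_real (gap r) * slope A (int r + 1)" if "r < N" for r
    using gap_pos[of r] that by (simp add: slope_def)
  \<comment> \<open>The state before resonator n + 1: the value on it and the slope in the gap to
    its left, hence the different index shifts in p and g.\<close>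
  define p where "p n = A (int n + 1)" for n
  define g where "g n = slope A (int n)" for n
  have Suc_int: "int (Suc n) + 1 = int n + 1 + 1" "int (Suc n) = int n + 1" for n by simp_all
  have step: "p (Suc n) = e11 (M n) * p n + e12 (M n) * g n" "g (Suc n) = e21 (M n) * p n + e22 (M n) * g n"
    if n: "n < N" for n
    unfolding p_def g_def Suc_int advance[OF n] jump[OF n]
    by (simp_all add: M_def cell_def mul2_def algebra_simps)
  have it: "p m = e11 (prod2 M m) * p 0 + e12 (prod2 M m) * g 0" "g m = e21 (prod2 M m) * p 0 + e22 (prod2 M m) * g 0"
    if "m \<le> N" for m
    using prod2_iterate[of m p M g] step that by simp_all
  have "(p 0, g 0) \<noteq> (0, 0)"
  proof
    assume z: "(p 0, g 0) = (0, 0)"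
    have "vec_index a r = 0" if "r < N" for r
      using it(1)[of r] z that by (simp add: p_def A_def)
    then have "a = 0\<^sub>v N" using a(1) by (intro eq_vecI) auto
    then show False using a(2) by simp
  qed
  moreover have "p N = \<kappa> * p 0" "g N = \<kappa> * g 0"
  proof -
    have A: "A (i + int N) = \<kappa> * A i" for i unfolding A_def by (rule bloch_ext_shift[OF \<kappa>])
    show "p N = \<kappa> * p 0" using A[of 1] by (simp add: p_def add.commute)
    show "g N = \<kappa> * g 0" using A[of 0] A[of 1] res_shift[of 0 1]
      by (simp add: g_def slope_def add.commute right_diff_distrib)
  qed
  ultimately have "\<exists>p q. (p, q) \<noteq> (0, 0) \<and> e11 (prod2 M N) * p + e12 (prod2 M N) * q = \<kappa> * p \<and>
      e21 (prod2 M N) * p + e22 (prod2 M N) * q = \<kappa> * q"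
    using it[of N] by (intro exI[of _ "p 0"] exI[of _ "g 0"]) simp
  moreover have "prod2 M N = monodromy k0 (\<lambda>r. 1 / (vr (Suc r))\<^sup>2) len gap N 1 \<mu> 0 0"
    by (simp add: monodromy_def M_def[abs_def])
  moreover have "det2 (monodromy k0 (\<lambda>r. 1 / (vr (Suc r))\<^sup>2) len gap N 1 \<mu> 0 0) = 1"
    using det_monodromy[of k0 "\<lambda>r. 1 / (vr (Suc r))\<^sup>2" len gap N \<mu> 0] by simp
  ultimately show ?thesis using unimodular_eigenvalue_iff[OF _ \<kappa>] by metis
qed

end

section \<open>The band functions\<close>

text \<open>z - 1 factors as (csqrt z - 1)(csqrt z + 1), and the principal root has nonnegative real
  part, so the second factor has modulus at least 1. The estimate therefore holds across the cut as
  well.\<close>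

lemma norm_csqrt_minus_1_le: "cmod (csqrt z - 1) \<le> cmod (z - 1)"
proof -
  have "1 \<le> Re (csqrt z + 1)" using csqrt_principal[of z] by auto
  also have "\<dots> \<le> cmod (csqrt z + 1)" by (rule complex_Re_le_cmod)
  finally have "cmod (csqrt z - 1) * 1 \<le> cmod (csqrt z - 1) * cmod (csqrt z + 1)"
    by (intro mult_left_mono) auto
  also have "\<dots> = cmod (csqrt z * csqrt z - 1)" by (simp add: norm_mult[symmetric] algebra_simps)
  finally show ?thesis by (simp add: csqrt_sq)
qed

text \<open>The multiplicity of a root equals the number of indices at which it is listed; order 1
  permits a single index.\<close>

lemma inj_on_simple_roots:
  fixes p :: "complex poly"
  assumes "proots p = image_mset lam (mset_set I)" "finite I" "\<And>i. i \<in> I \<Longrightarrow> Polynomial.order (lam i) p = 1"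
  shows "inj_on lam I"
proof (rule inj_onI)
  fix i j assume ij: "i \<in> I" "j \<in> I" "lam i = lam j"
  have "mset_set I \<noteq> {#}" using ij(1) assms(2) by (auto simp: mset_set_empty_iff)
  then have "p \<noteq> 0" using assms(1) by auto
  then have "count (image_mset lam (mset_set I)) (lam i) = 1"
    using assms(1)[symmetric] assms(3)[OF ij(1)] by simp
  then have "card (lam -` {lam i} \<inter> I) = 1"
    using assms(2) by (simp add: count_image_mset)
  then obtain x where "lam -` {lam i} \<inter> I = {x}" by (auto simp: card_1_singleton_iff)
  then have "i \<in> {x}" "j \<in> {x}" using ij by auto
  then show "i = j" by simp
qed

text \<open>The factorisation keeps the branch of \<open>csqrt (\<delta> * \<lambda>)\<close>, also when \<open>\<lambda>\<close> lies on the branch cut.\<close>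

definition branch :: "complex \<Rightarrow> complex \<Rightarrow> real \<Rightarrow> complex" where
  "branch l y \<delta> = (if l = 0 then csqrt (of_real \<delta> * y) else csqrt (of_real \<delta> * l) * csqrt (y / l))"

lemma branch_square: "(branch l y \<delta>)\<^sup>2 = of_real \<delta> * y"
  by (simp add: branch_def power_mult_distrib)

text \<open>For l = 0 the square \<delta> y is O(\<delta>^2). Otherwise the difference is
  csqrt(\<delta> l) times csqrt(y/l) - 1; the second factor is O(\<delta>) and boundedness of the
  first suffices.\<close>

lemma branch_bigo:
  assumes "\<forall>\<^sub>F \<delta> in at_right 0. cmod (y \<delta> - l) \<le> K * \<delta>"
  shows "(\<lambda>\<delta>. branch l (y \<delta>) \<delta> - csqrt (of_real \<delta> * l)) \<in> O[at_right 0](\<lambda>\<delta>. complex_of_real \<delta>)"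
proof -
  have small: "\<forall>\<^sub>F \<delta> in at_right (0::real). 0 < \<delta> \<and> \<delta> \<le> 1"
    unfolding eventually_at_right_field by (intro exI[of _ 1]) auto
  show ?thesis
  proof (cases "l = 0")
    case True
    \<comment> \<open>K is at most (|K| + 1)^2, also when K is negative, so |K| + 1 replaces the
      square root of K as constant.\<close>
    have "\<forall>\<^sub>F \<delta> in at_right 0. cmod (branch l (y \<delta>) \<delta> - csqrt (of_real \<delta> * l)) \<le> (\<bar>K\<bar> + 1) * cmod (complex_of_real \<delta>)"
      using assms small
    proof eventually_elim
      case (elim \<delta>)
      have "(cmod (branch l (y \<delta>) \<delta>))\<^sup>2 = \<delta> * cmod (y \<delta>)"
        using branch_square[of l "y \<delta>" \<delta>] elim by (simp add: norm_power[symmetric] norm_mult)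
      also have "\<dots> \<le> \<delta> * (K * \<delta>)" using elim True by (intro mult_left_mono) auto
      also have "\<dots> \<le> \<delta> * (((\<bar>K\<bar> + 1) * (\<bar>K\<bar> + 1)) * \<delta>)"
      proof -
        have "K \<le> 1 * (\<bar>K\<bar> + 1)" by simp
        also have "\<dots> \<le> (\<bar>K\<bar> + 1) * (\<bar>K\<bar> + 1)" by (rule mult_right_mono) auto
        finally show ?thesis using elim by (intro mult_left_mono mult_right_mono) auto
      qed
      also have "\<dots> = ((\<bar>K\<bar> + 1) * \<delta>)\<^sup>2" by (simp add: power2_eq_square)
      finally have "cmod (branch l (y \<delta>) \<delta>) \<le> (\<bar>K\<bar> + 1) * \<delta>"
        by (rule power2_le_imp_le) (use elim in simp)
      then show ?case using True elim by simp
    qed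
    then show ?thesis by (rule bigoI)
  next
    case False
    define c where "c = (cmod l + 1) * (K / cmod l)"
    have "\<forall>\<^sub>F \<delta> in at_right 0. cmod (branch l (y \<delta>) \<delta> - csqrt (of_real \<delta> * l)) \<le> c * cmod (complex_of_real \<delta>)"
      using assms small
    proof eventually_elim
      case (elim \<delta>)
      have "(cmod (csqrt (of_real \<delta> * l)))\<^sup>2 = \<delta> * cmod l"
        using elim by (simp add: norm_power[symmetric] norm_mult)
      also have "\<dots> \<le> 1 * cmod l" using elim by (intro mult_right_mono) auto
      also have "\<dots> \<le> (cmod l + 1)\<^sup>2" by (simp add: power2_eq_square algebra_simps)
      finally have A: "cmod (csqrt (of_real \<delta> * l)) \<le> cmod l + 1" by (rule power2_le_imp_le) simp
      have "y \<delta> / l - 1 = (y \<delta> - l) / l" using False by (simp add: diff_divide_distrib)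
      then have "cmod (y \<delta> / l - 1) = cmod (y \<delta> - l) / cmod l" by (simp only: norm_divide)
      also have "\<dots> \<le> K * \<delta> / cmod l" using elim by (intro divide_right_mono) auto
      finally have B: "cmod (csqrt (y \<delta> / l) - 1) \<le> K * \<delta> / cmod l"
        using norm_csqrt_minus_1_le[of "y \<delta> / l"] by linarith
      have "branch l (y \<delta>) \<delta> - csqrt (of_real \<delta> * l) = csqrt (of_real \<delta> * l) * (csqrt (y \<delta> / l) - 1)"
        using False by (simp add: branch_def right_diff_distrib)
      then have "cmod (branch l (y \<delta>) \<delta> - csqrt (of_real \<delta> * l)) = cmod (csqrt (of_real \<delta> * l)) * cmod (csqrt (y \<delta> / l) - 1)"
        by (simp only: norm_mult)
      also have "\<dots> \<le> (cmod l + 1) * (K * \<delta> / cmod l)"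
        using A B by (intro mult_mono) auto
      finally show ?case using elim by (simp add: c_def)
    qed
    then show ?thesis by (rule bigoI)
  qed
qed

text \<open>Resonances come in pairs of opposite sign, and each \<omega> i represents one pair.
  Distinctness and exhaustion together say that there are exactly N pairs of germs of values. The
  index in the exhaustion clause may vary with \<delta>, since w is not assumed continuous and may
  jump between pairs. The sign convention is that of the principal root
  \<open>csqrt\<close>.\<close>

theorem proposition4p9:
  fixes N :: nat and L v \<alpha> :: real and xL xR :: "int \<Rightarrow> real"
    and vr lam :: "nat \<Rightarrow> complex" and a :: "nat \<Rightarrow> complex Matrix.vec"
  assumes "resonator_chain N L xL xR"
    and "v > 0"
    and "\<forall>i\<in>{1..N}. vr i \<noteq> 0"
    and "proots (char_poly (gen_cap_matrix N L xL xR vr \<alpha>)) = image_mset lam (mset_set {1..N})"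
    and "\<forall>i\<in>{1..N}. eigenvector (gen_cap_matrix N L xL xR vr \<alpha>) (a i) (lam i)"
    and "\<forall>i\<in>{1..N}. Polynomial.order (lam i) (char_poly (gen_cap_matrix N L xL xR vr \<alpha>)) = 1"
  shows "\<exists>\<omega> :: nat \<Rightarrow> real \<Rightarrow> complex.
      (\<forall>i\<in>{1..N}. subwavelength_resonance N L xL xR v vr \<alpha> (\<omega> i)) \<and>
      (\<forall>i\<in>{1..N}. \<forall>j\<in>{1..N}. i \<noteq> j \<longrightarrow>
         (\<forall>\<^sub>F \<delta> in at_right 0. \<omega> i \<delta> \<noteq> \<omega> j \<delta> \<and> \<omega> i \<delta> \<noteq> - \<omega> j \<delta>)) \<and>
      (\<forall>w. subwavelength_resonance N L xL xR v vr \<alpha> w \<longrightarrow>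
         (\<forall>\<^sub>F \<delta> in at_right 0. \<exists>i\<in>{1..N}. w \<delta> = \<omega> i \<delta> \<or> w \<delta> = - \<omega> i \<delta>)) \<and>
      (\<forall>i\<in>{1..N}. (\<lambda>\<delta>. \<omega> i \<delta> - csqrt (complex_of_real \<delta> * lam i)) \<in> O[at_right 0](\<lambda>\<delta>. complex_of_real \<delta>))"
proof -
  interpret chain N L xL xR by unfold_locales (rule assms(1))
  define \<kappa> where "\<kappa> = cis (\<alpha> * L)"
  define k where "k r = 1 / (vr (Suc r))\<^sup>2" for r
  define k0 where "k0 = 1 / (complex_of_real v)\<^sup>2"
  define F where "F \<delta> \<mu> = tr2 (monodromy k0 k len gap N 1 \<mu> (of_real \<delta> * \<mu>) \<delta>) - (\<kappa> + 1 / \<kappa>)" for \<delta> \<mu>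
  have inj: "inj_on lam {1..N}" using inj_on_simple_roots[OF assms(4)] assms(6) by simp
  have zero: "F 0 (lam i) = 0" if "i \<in> {1..N}" for i
    using cap_eigenvalue_trace[of vr \<alpha> "a i" "lam i" k0] assms(3,5) that
    by (simp add: F_def k_def[abs_def] \<kappa>_def)
  have nz: "k r \<noteq> 0 \<and> len r \<noteq> 0 \<and> gap r \<noteq> 0" if "r < N" for r
    using len_pos[of r] gap_pos[of r] assms(3) that by (simp add: k_def)
  obtain y \<eta> where \<eta>: "0 < \<eta>"
    and y: "\<forall>i\<in>{1..N}. \<exists>K. \<forall>\<^sub>F \<delta> in at_right 0. F \<delta> (y i \<delta>) = 0 \<and> cmod (y i \<delta> - lam i) \<le> K * \<delta>"
    and all: "\<forall>\<^sub>F \<delta> in at_right 0. \<forall>\<mu>. cmod (of_real \<delta> * \<mu>) < \<eta> \<longrightarrow> F \<delta> \<mu> = 0 \<longrightarrow> (\<exists>i\<in>{1..N}. \<mu> = y i \<delta>)"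
    using discriminant_roots[of N k len gap lam F k0 "\<kappa> + 1 / \<kappa>", OF N_pos nz inj F_def zero] by blast
  define \<omega> where "\<omega> i \<delta> = branch (lam i) (y i \<delta>) \<delta>" for i \<delta>
  have sq: "(\<omega> i \<delta>)\<^sup>2 = of_real \<delta> * y i \<delta>" for i \<delta> by (simp add: \<omega>_def branch_square)
  have pos: "\<forall>\<^sub>F \<delta> in at_right (0::real). 0 < \<delta>" by (rule eventually_at_right_less)
  have res_iff: "scattering_resonance N L xL xR v vr \<alpha> \<delta> w \<longleftrightarrow> F \<delta> (w\<^sup>2 / of_real \<delta>) = 0" if "\<delta> > 0" for \<delta> w
    using scattering_resonance_iff[OF that, of v vr \<alpha> w] that
    by (simp add: F_def k_def[abs_def] k0_def \<kappa>_def)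
  have id0: "(complex_of_real \<longlongrightarrow> 0) (at_right 0)"
    using tendsto_of_real[OF tendsto_ident_at[of "0::real" "{0<..}"]] by simp
  have y_lim: "(y i \<longlongrightarrow> lam i) (at_right 0)" if i: "i \<in> {1..N}" for i
  proof -
    obtain K where K: "\<forall>\<^sub>F \<delta> in at_right 0. F \<delta> (y i \<delta>) = 0 \<and> cmod (y i \<delta> - lam i) \<le> K * \<delta>" using y i by blast
    have "((\<lambda>\<delta>. K * \<delta>) \<longlongrightarrow> 0) (at_right 0)"
      using tendsto_mult_left[OF tendsto_ident_at[of "0::real" "{0<..}"], of K] by simp
    then have "((\<lambda>\<delta>. y i \<delta> - lam i) \<longlongrightarrow> 0) (at_right 0)"
      by (rule Lim_null_comparison[rotated]) (use K in \<open>auto elim: eventually_mono\<close>)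
    then show ?thesis by (rule LIM_zero_cancel)
  qed
  have sub: "subwavelength_resonance N L xL xR v vr \<alpha> (\<omega> i)" if i: "i \<in> {1..N}" for i
  proof -
    obtain K where K: "\<forall>\<^sub>F \<delta> in at_right 0. F \<delta> (y i \<delta>) = 0 \<and> cmod (y i \<delta> - lam i) \<le> K * \<delta>" using y i by blast
    have "\<forall>\<^sub>F \<delta> in at_right 0. scattering_resonance N L xL xR v vr \<alpha> \<delta> (\<omega> i \<delta>)"
      using K pos by eventually_elim (simp add: res_iff sq)
    \<comment> \<open>Convergence to 0 is read off from the modulus of the square, which avoids
      continuity of \<open>csqrt\<close> along the cut.\<close>
    moreover have "((\<lambda>\<delta>. sqrt (cmod ((\<omega> i \<delta>)\<^sup>2))) \<longlongrightarrow> sqrt (cmod (0 * lam i))) (at_right 0)"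
      unfolding sq by (intro tendsto_intros id0 y_lim i)
    then have "((\<lambda>\<delta>. cmod (\<omega> i \<delta>)) \<longlongrightarrow> 0) (at_right 0)" by (simp add: norm_power)
    ultimately show ?thesis by (simp add: subwavelength_resonance_def tendsto_norm_zero_iff)
  qed
  have distinct: "\<forall>\<^sub>F \<delta> in at_right 0. \<omega> i \<delta> \<noteq> \<omega> j \<delta> \<and> \<omega> i \<delta> \<noteq> - \<omega> j \<delta>"
    if ij: "i \<in> {1..N}" "j \<in> {1..N}" "i \<noteq> j" for i j
  proof -
    have "lam i - lam j \<noteq> 0" using inj ij by (auto simp: inj_on_eq_iff)
    then have "\<forall>\<^sub>F \<delta> in at_right 0. y i \<delta> - y j \<delta> \<noteq> 0"
      by (rule tendsto_imp_eventually_ne[OF tendsto_diff[OF y_lim y_lim], rotated -1]) (use ij in auto)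
    then show ?thesis using pos
    proof eventually_elim
      case (elim \<delta>)
      then have "(\<omega> i \<delta>)\<^sup>2 \<noteq> (\<omega> j \<delta>)\<^sup>2" by (simp add: sq)
      then show ?case by (auto simp: power2_eq_iff)
    qed
  qed
  have complete: "\<forall>\<^sub>F \<delta> in at_right 0. \<exists>i\<in>{1..N}. w \<delta> = \<omega> i \<delta> \<or> w \<delta> = - \<omega> i \<delta>"
    if w: "subwavelength_resonance N L xL xR v vr \<alpha> w" for w
  proof -
    \<comment> \<open>Only w^2 = \<delta> \<mu> is controlled here, while \<mu> itself might still
      be large; this is exactly what the hypothesis of \<open>all\<close> asks for.\<close>
    have "((\<lambda>\<delta>. (w \<delta>)\<^sup>2) \<longlongrightarrow> 0\<^sup>2) (at_right 0)"
      using w by (intro tendsto_intros) (simp add: subwavelength_resonance_def)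
    then have "\<forall>\<^sub>F \<delta> in at_right 0. dist ((w \<delta>)\<^sup>2) (0\<^sup>2) < \<eta>" using \<eta> by (rule tendstoD)
    moreover have "\<forall>\<^sub>F \<delta> in at_right 0. scattering_resonance N L xL xR v vr \<alpha> \<delta> (w \<delta>)"
      using w by (simp add: subwavelength_resonance_def)
    ultimately show ?thesis using all pos
    proof eventually_elim
      case (elim \<delta>)
      define \<mu> where "\<mu> = (w \<delta>)\<^sup>2 / of_real \<delta>"
      have \<mu>: "of_real \<delta> * \<mu> = (w \<delta>)\<^sup>2" using elim by (simp add: \<mu>_def)
      have "F \<delta> \<mu> = 0" using elim res_iff by (simp add: \<mu>_def)
      moreover have "cmod (of_real \<delta> * \<mu>) < \<eta>" using elim(1) unfolding \<mu> by simp
      ultimately obtain i where i: "i \<in> {1..N}" "\<mu> = y i \<delta>" using elim(3) by blast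
      then have "(w \<delta>)\<^sup>2 = (\<omega> i \<delta>)\<^sup>2" using \<mu> by (simp add: sq)
      then show ?case using i(1) by (auto simp: power2_eq_iff)
    qed
  qed
  have asymp: "(\<lambda>\<delta>. \<omega> i \<delta> - csqrt (complex_of_real \<delta> * lam i)) \<in> O[at_right 0](\<lambda>\<delta>. complex_of_real \<delta>)"
    if i: "i \<in> {1..N}" for i
  proof -
    obtain K where K: "\<forall>\<^sub>F \<delta> in at_right 0. F \<delta> (y i \<delta>) = 0 \<and> cmod (y i \<delta> - lam i) \<le> K * \<delta>" using y i by blast
    then have "\<forall>\<^sub>F \<delta> in at_right 0. cmod (y i \<delta> - lam i) \<le> K * \<delta>" by eventually_elim simp
    from branch_bigo[OF this] show ?thesis by (simp add: \<omega>_def)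
  qed
  show ?thesis using sub distinct complete asymp by (intro exI[of _ \<omega>]) blast
qed

end
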